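(* Let $\mathbb{G}$ be a homogeneous group of homogeneous dimension $Q=2$, let $|\cdot|$ be any homogeneous quasi-norm on $\mathbb{G}$, and let $R>0$. Then for each $f\in C_{0}^{\infty}(B(0,R)\setminus\{0\})$, $$\left(\int_{B(0,R)}\frac{1}{|x|^{2}\left|\log\frac{R}{|x|}\right|^{2}}\left|f(x)-f\left(R\frac{x}{|x|}\right)\right|^{2}dx\right)^{\frac12}\leq 2\left(\int_{B(0,R)}|\mathcal{R}f|^{2}dx\right)^{\frac12},$$ and $$\left(\int_{B(0,R)}\frac{|f(x)|^{2}}{|x|^{2}\left(1+\left|\log\frac{R}{|x|}\right|\right)^{2}}dx\right)^{\frac12}\leq\frac{\sqrt{2}}{R}\left(\int_{B(0,R)}|f(x)|^{2}dx\right)^{\frac12}+2\left(1+\sqrt{2}\right)\left(\int_{B(0,R)}|\mathcal{R}f|^{2}dx\right)^{\frac12}.$$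
   Context: A homogeneous group $\mathbb{G}$ is a connected simply connected Lie group whose Lie algebra $\mathfrak{g}$ is equipped with a family of dilations $D_{\lambda}=\mathrm{Exp}(A\ln\lambda)=\sum_{k\ge 0}\frac{1}{k!}(\ln(\lambda)A)^{k}$, $\lambda>0$, where $A$ is a diagonalisable linear operator on $\mathfrak{g}$ with positive eigenvalues and each $D_{\lambda}$ is a Lie algebra morphism. Such a group is nilpotent, the exponential map $\mathfrak{g}\to\mathbb{G}$ is a global diffeomorphism, and the dilations are transported to $\mathbb{G}$ via it; write $\lambda x:=D_{\lambda}x$ for $x\in\mathbb{G}$. The unit element of $\mathbb{G}$ is denoted $0$. The homogeneous dimension is $Q=\mathrm{Tr}\,A$, and $dx$ denotes Haar measure. A homogeneous quasi-norm is a continuous function $|\cdot|:\mathbb{G}\to[0,\infty)$ with $|x^{-1}|=|x|$, $|\lambda x|=\lambda|x|$ for all $x\in\mathbb{G}$, $\lambda>0$, and $|x|=0$ if and only if $x=0$. $B(0,R)=\{x\in\mathbb{G}:|x|<R\}$ is the quasi-ball with respect to $|\cdot|$. For $x\neq 0$, $R\frac{x}{|x|}$ denotes $D_{R/|x|}x$. The radial operator $\mathcal{R}=\frac{d}{d|x|}$ is defined by $\mathcal{R}f(x)=\frac{d}{dr}f(D_{r}y)\big|_{r=|x|}$, where $y=D_{1/|x|}x$ (so $|y|=1$). Functions are complex-valued; functions in $C_0^\infty(B(0,R)\setminus\{0\})$ (smooth, compactly supported in $B(0,R)\setminus\{0\}$) are regarded as functions on $\mathbb{G}$ via extension by zero.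 *)

theory Defs
  imports "HOL-Analysis.Analysis"
begin

section \<open>Smooth functions on a Euclidean space\<close>

primrec C_k :: "nat \<Rightarrow> ('a::euclidean_space \<Rightarrow> 'b::real_normed_vector) \<Rightarrow> bool" where
  "C_k 0 f \<longleftrightarrow> continuous_on UNIV f"
| "C_k (Suc k) f \<longleftrightarrow> (\<forall>x. f differentiable (at x)) \<and>
     (\<forall>v. C_k k (\<lambda>x. frechet_derivative f (at x) v))"

definition smooth :: "('a::euclidean_space \<Rightarrow> 'b::real_normed_vector) \<Rightarrow> bool" where
  "smooth f \<longleftrightarrow> (\<forall>k. C_k k f)"

section \<open>Lie groups with a global exponential chart\<close>

text \<open>
  The group is a type of class \<^class>\<open>topological_group_add\<close>. Its law is not assumed commutative;
  it is written additively, so that the unit is \<^term>\<open>0\<close> and the inverse of \<open>x\<close> is \<open>- x\<close>.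

  The exponential map of the connected simply connected Lie group of a homogeneous group is a
  global diffeomorphism from the Lie algebra \<open>'a\<close>. It therefore serves as the single chart that
  carries the smooth structure of the group. Connectedness and simple connectedness follow from it
  being a homeomorphism. That lines through the origin go to one-parameter subgroups says that this
  chart is the exponential map: the tangent space at the unit is identified with \<open>'a\<close> through the
  chart, and \<open>t \<mapsto> expG (t *\<^sub>R X)\<close> has velocity \<open>X\<close> at \<open>t = 0\<close>.
\<close>

locale exponential_lie_group =
  fixes expG :: "'a::euclidean_space \<Rightarrow> 'g::topological_group_add"
  assumes bij_exp: "bij expG"
    and continuous_exp: "continuous_on UNIV expG"
    and continuous_log: "continuous_on UNIV (inv expG)"
    and smooth_mult: "smooth (\<lambda>p::'a \<times> 'a. inv expG (expG (fst p) + expG (snd p)))"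
    and smooth_inverse: "smooth (\<lambda>X. inv expG (- expG X))"
    and one_parameter: "\<And>s t X. expG ((s + t) *\<^sub>R X) = expG (s *\<^sub>R X) + expG (t *\<^sub>R X)"

definition smooth_fun :: "('a::euclidean_space \<Rightarrow> 'g) \<Rightarrow> ('g \<Rightarrow> 'b::real_normed_vector) \<Rightarrow> bool" where
  "smooth_fun expG f \<longleftrightarrow> smooth (\<lambda>X. f (expG X))"

definition left_invariant_field ::
  "('a::euclidean_space \<Rightarrow> 'g::topological_group_add) \<Rightarrow> 'a \<Rightarrow> 'a \<Rightarrow> 'a" where
  "left_invariant_field expG X p =
     frechet_derivative (\<lambda>Y. inv expG (expG p + expG Y)) (at 0) X"

definition field_bracket ::
  "('a::euclidean_space \<Rightarrow> 'a) \<Rightarrow> ('a \<Rightarrow> 'a) \<Rightarrow> 'a \<Rightarrow> 'a" where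
  "field_bracket V W p = frechet_derivative W (at p) (V p) - frechet_derivative V (at p) (W p)"

text \<open>The bracket of the Lie algebra, as the value at the unit of the bracket of the corresponding
  left-invariant vector fields (all written in the exponential chart).\<close>

definition lie_bracket ::
  "('a::euclidean_space \<Rightarrow> 'g::topological_group_add) \<Rightarrow> 'a \<Rightarrow> 'a \<Rightarrow> 'a" where
  "lie_bracket expG X Y =
     field_bracket (left_invariant_field expG X) (left_invariant_field expG Y) 0"

definition lie_algebra_morphism ::
  "('a::euclidean_space \<Rightarrow> 'g::topological_group_add) \<Rightarrow> ('a \<Rightarrow> 'a) \<Rightarrow> bool" where
  "lie_algebra_morphism expG T \<longleftrightarrow>
     linear T \<and> (\<forall>X Y. T (lie_bracket expG X Y) = lie_bracket expG (T X) (T Y))"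

section \<open>Homogeneous groups\<close>

definition diagonalisable :: "('a::euclidean_space \<Rightarrow> 'a) \<Rightarrow> bool" where
  "diagonalisable A \<longleftrightarrow>
     (\<exists>B. independent B \<and> span B = UNIV \<and> (\<forall>b\<in>B. \<exists>c. A b = c *\<^sub>R b))"

definition algebra_dilation :: "('a::euclidean_space \<Rightarrow> 'a) \<Rightarrow> real \<Rightarrow> 'a \<Rightarrow> 'a" where
  "algebra_dilation A l X = (\<Sum>k. (1 / fact k) *\<^sub>R (((\<lambda>Y. ln l *\<^sub>R A Y) ^^ k) X))"

locale homogeneous_group = exponential_lie_group expG
  for expG :: "'a::euclidean_space \<Rightarrow> 'g::topological_group_add" +
  fixes A :: "'a \<Rightarrow> 'a"
  assumes linear_A: "linear A"
    and diagonalisable_A: "diagonalisable A"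
    and positive_eigenvalues: "\<And>c X. X \<noteq> 0 \<Longrightarrow> A X = c *\<^sub>R X \<Longrightarrow> c > 0"
    and dilation_morphism: "\<And>l. l > 0 \<Longrightarrow> lie_algebra_morphism expG (algebra_dilation A l)"

definition dilation ::
  "('a::euclidean_space \<Rightarrow> 'g) \<Rightarrow> ('a \<Rightarrow> 'a) \<Rightarrow> real \<Rightarrow> 'g \<Rightarrow> 'g" where
  "dilation expG A l x = expG (algebra_dilation A l (inv expG x))"

text \<open>The trace of \<open>A\<close>, computed in the standard orthonormal basis of the underlying Euclidean space.\<close>

definition homogeneous_dimension :: "('a::euclidean_space \<Rightarrow> 'a) \<Rightarrow> real" where
  "homogeneous_dimension A = (\<Sum>b\<in>Basis. A b \<bullet> b)"

definition homogeneous_quasi_norm ::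
  "('a::euclidean_space \<Rightarrow> 'g::topological_group_add) \<Rightarrow> ('a \<Rightarrow> 'a) \<Rightarrow> ('g \<Rightarrow> real) \<Rightarrow> bool" where
  "homogeneous_quasi_norm expG A N \<longleftrightarrow>
     continuous_on UNIV N \<and>
     (\<forall>x. N x \<ge> 0) \<and>
     (\<forall>x. N (- x) = N x) \<and>
     (\<forall>l>0. \<forall>x. N (dilation expG A l x) = l * N x) \<and>
     (\<forall>x. N x = 0 \<longleftrightarrow> x = 0)"

definition quasi_ball :: "('g \<Rightarrow> real) \<Rightarrow> real \<Rightarrow> 'g set" where
  "quasi_ball N R = {x. N x < R}"

text \<open>Regularity is automatic, since the groups considered here are homeomorphic to a Euclidean
  space. They are nilpotent, so left and right Haar measures coincide.\<close>

definition haar_measure :: "'g::topological_group_add measure \<Rightarrow> bool" where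
  "haar_measure M \<longleftrightarrow>
     sets M = sets borel \<and>
     (\<forall>K. compact K \<longrightarrow> emeasure M K < \<infinity>) \<and>
     emeasure M UNIV \<noteq> 0 \<and>
     (\<forall>a. distr M borel (\<lambda>x. a + x) = M)"

text \<open>Functions on \<open>U\<close> are represented by their extensions by zero to the whole group.\<close>

definition smooth_compactly_supported ::
  "('a::euclidean_space \<Rightarrow> 'g::topological_space) \<Rightarrow> 'g set \<Rightarrow> ('g \<Rightarrow> complex) \<Rightarrow> bool" where
  "smooth_compactly_supported expG U f \<longleftrightarrow>
     smooth_fun expG f \<and> compact (closure {x. f x \<noteq> 0}) \<and> closure {x. f x \<noteq> 0} \<subseteq> U"

definition radial_derivative ::
  "('a::euclidean_space \<Rightarrow> 'g) \<Rightarrow> ('a \<Rightarrow> 'a) \<Rightarrow> ('g \<Rightarrow> real) \<Rightarrow> ('g \<Rightarrow> complex) \<Rightarrow> 'g \<Rightarrow> complex" where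
  "radial_derivative expG A N f x =
     vector_derivative (\<lambda>r. f (dilation expG A r (dilation expG A (1 / N x) x))) (at (N x))"

end

theory Submission
  imports Defs
begin

text \<open>
  Since \<open>f\<close> is supported inside the open quasi-ball, it vanishes at \<open>R x / |x|\<close>, so the first
  inequality is the logarithmic Hardy inequality
  \<open>\<integral> |f|\<^sup>2 / (|x|\<^sup>2 log\<^sup>2 (R / |x|)) \<le> 4 \<integral> |\<R>f|\<^sup>2\<close>, and it implies the second one
  because \<open>1 + log (R / |x|) \<ge> log (R / |x|)\<close> on the support.

  No polar decomposition is needed. If Haar measure scales by \<open>\<lambda>\<^sup>2\<close> under dilations, then
  differentiating \<open>\<integral> g (\<lambda>x) dx = \<lambda>\<^sup>-\<^sup>2 \<integral> g\<close> at \<open>\<lambda> = 1\<close> gives \<open>\<integral> |x| \<R>g = - 2 \<integral> g\<close>; for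
  \<open>g = |f|\<^sup>2 / (|x|\<^sup>2 log (R / |x|))\<close> this expresses the left-hand side through
  \<open>Re (f\<^sup>* \<R>f) / (|x| log (R / |x|))\<close>, and Young's inequality finishes the proof.

  For the scaling, let \<open>\<omega> p\<close> be the derivative at \<open>p\<close> of left translation by \<open>p\<^sup>-\<^sup>1\<close> in the
  exponential chart. Then \<open>|det (\<omega> p)| dp\<close> is left invariant, hence proportional to Haar measure.
  By the Maurer--Cartan equation \<open>t \<omega> (t X)\<close> solves the linear equation \<open>s' = 1 - ad X s\<close>, so
  \<open>D (\<omega> X) = \<omega> (D X) D\<close> for every Lie algebra morphism \<open>D\<close>. Therefore \<open>det \<omega>\<close> is invariant under
  dilations, and Haar measure scales by \<open>det D\<^sub>\<lambda> = \<lambda>\<^sup>Q\<close>.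
\<close>

section \<open>Change of variables on a Euclidean space\<close>

text \<open>The library states the change of variables formula for \<^typ>\<open>real ^ 'n\<close> with a finite
  well-ordered index type. This index type transports it to an arbitrary Euclidean space.\<close>

typedef (overloaded) ('a::euclidean_space) dim_index = "{..<DIM('a)}"
  using DIM_positive[where 'a='a] by blast

instantiation dim_index :: (euclidean_space) wellorder
begin
definition "i \<le> j \<longleftrightarrow> Rep_dim_index i \<le> Rep_dim_index j"
definition "i < j \<longleftrightarrow> Rep_dim_index i < Rep_dim_index j"
instance
proof
  fix P :: "'a dim_index \<Rightarrow> bool" and a :: "'a dim_index"
  assume step: "\<And>x. (\<And>y. y < x \<Longrightarrow> P y) \<Longrightarrow> P x"
  show "P a"
    by (induction a rule: measure_induct_rule[of Rep_dim_index]) (rule step, simp add: less_dim_index_def)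
qed (auto simp: less_eq_dim_index_def less_dim_index_def Rep_dim_index_inject)
end

instance dim_index :: (euclidean_space) finite
proof
  have "(UNIV :: 'a dim_index set) = Abs_dim_index ` {..<DIM('a)}"
    using type_definition.Abs_image[OF type_definition_dim_index] by metis
  then show "finite (UNIV :: 'a dim_index set)" by (metis finite_imageI finite_lessThan)
qed

section \<open>Coordinates, Lebesgue measure and determinants on an arbitrary Euclidean
  space\<close>

definition basis_enum :: "'a::euclidean_space dim_index \<Rightarrow> 'a" where
  "basis_enum i = (SOME h. bij_betw h {..<DIM('a)} Basis) (Rep_dim_index i)"

lemma bij_betw_basis_enum: "bij_betw (basis_enum :: 'a::euclidean_space dim_index \<Rightarrow> 'a) UNIV Basis"
proof -
  have "\<exists>h. bij_betw h {..<DIM('a)} (Basis :: 'a set)"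
    using ex_bij_betw_nat_finite[OF finite_Basis] by (metis atLeast0LessThan)
  then have h: "bij_betw (SOME h. bij_betw h {..<DIM('a)} (Basis :: 'a set)) {..<DIM('a)} Basis"
    by (rule someI_ex)
  have R: "bij_betw (Rep_dim_index :: 'a dim_index \<Rightarrow> nat) UNIV {..<DIM('a)}"
    using type_definition.Rep_range[OF type_definition_dim_index]
    by (auto simp: bij_betw_def inj_on_def Rep_dim_index_inject)
  show ?thesis
    using bij_betw_trans[OF R h] by (simp add: basis_enum_def[abs_def] o_def)
qed

lemma inner_basis_enum: "basis_enum i \<bullet> basis_enum j = (if i = j then 1 else 0)"
proof -
  have "basis_enum i \<in> Basis" "basis_enum j \<in> Basis" "basis_enum i = basis_enum j \<longleftrightarrow> i = j"
    using bij_betw_basis_enum by (auto simp: bij_betw_def inj_on_def)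
  then show ?thesis by (simp add: inner_Basis)
qed

definition to_vec :: "'a::euclidean_space \<Rightarrow> real ^ 'a dim_index" where
  "to_vec x = (\<chi> i. x \<bullet> basis_enum i)"

definition of_vec :: "real ^ 'a dim_index \<Rightarrow> 'a::euclidean_space" where
  "of_vec v = (\<Sum>i\<in>UNIV. v $ i *\<^sub>R basis_enum i)"

lemma sum_basis_enum: "(\<Sum>i\<in>UNIV. g (basis_enum i)) = (\<Sum>b\<in>Basis. g b)"
  using sum.reindex_bij_betw[OF bij_betw_basis_enum] by blast

lemma prod_basis_enum: "(\<Prod>i\<in>UNIV. g (basis_enum i)) = (\<Prod>b\<in>Basis. g b)"
  using prod.reindex_bij_betw[OF bij_betw_basis_enum] by blast

lemma ball_Basis_iff: "(\<forall>b\<in>Basis. P b) \<longleftrightarrow> (\<forall>i. P (basis_enum i))"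
  using bij_betw_basis_enum by (metis bij_betw_def rangeE rangeI)

lemma of_vec_to_vec [simp]: "of_vec (to_vec x) = x"
  by (simp add: of_vec_def to_vec_def sum_basis_enum[of "\<lambda>b. (x \<bullet> b) *\<^sub>R b"] euclidean_representation)

lemma of_vec_inner [simp]: "of_vec v \<bullet> basis_enum i = v $ i"
  by (simp add: of_vec_def inner_sum_left inner_basis_enum if_distrib[of "times _"] cong: if_cong)

lemma to_vec_of_vec [simp]: "to_vec (of_vec v) = v"
  by (simp add: to_vec_def vec_eq_iff)

lemma bounded_linear_to_vec: "bounded_linear to_vec"
  by (rule linear_conv_bounded_linear[THEN iffD1], rule linearI)
     (auto simp: to_vec_def vec_eq_iff inner_add_left)

lemma bounded_linear_of_vec: "bounded_linear of_vec"
  by (rule linear_conv_bounded_linear[THEN iffD1], rule linearI)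
     (auto simp: of_vec_def algebra_simps sum.distrib scaleR_sum_right)

lemmas linear_to_vec = bounded_linear.linear[OF bounded_linear_to_vec]
lemmas linear_of_vec = bounded_linear.linear[OF bounded_linear_of_vec]

lemma borel_measurable_of_vec [measurable]: "of_vec \<in> borel_measurable borel"
  by (intro borel_measurable_continuous_onI linear_continuous_on bounded_linear_of_vec)

lemma of_vec_vimage_box: "of_vec -` box l u = box (to_vec l) (to_vec u)"
  by (auto simp: box_def ball_Basis_iff Basis_vec_def inner_axis) (auto simp: to_vec_def)

text \<open>Lebesgue measure is determined by its values on boxes, and \<open>of_vec\<close> pulls a
  box back to a box with the same side lengths. Integrals can therefore be computed in
  coordinates.\<close>

lemma lborel_eq_distr_of_vec: "lborel = distr lborel borel of_vec"
proof (rule lborel_eqI)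
  fix l u :: 'a assume lu: "\<And>b. b \<in> Basis \<Longrightarrow> l \<bullet> b \<le> u \<bullet> b"
  have "emeasure (distr lborel borel of_vec) (box l u) = emeasure lborel (box (to_vec l) (to_vec u))"
    by (simp add: emeasure_distr of_vec_vimage_box)
  also have "\<dots> = (\<Prod>b\<in>Basis. (to_vec u - to_vec l) \<bullet> b)"
    using lu[unfolded Ball_def[symmetric]]
    by (intro emeasure_lborel_box) (auto simp: ball_Basis_iff Basis_vec_def inner_axis to_vec_def lu[rule_format] bij_betwE[OF bij_betw_basis_enum])
  also have "(\<Prod>b\<in>Basis. (to_vec u - to_vec l) \<bullet> b) = (\<Prod>i\<in>UNIV. (to_vec u - to_vec l) $ i)"
    by (simp add: Basis_vec_def cart_eq_inner_axis axis_eq_axis prod.reindex UNION_singleton_eq_range inj_on_def )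
  also have "\<dots> = (\<Prod>b\<in>Basis. (u - l) \<bullet> b)"
    by (simp add: to_vec_def inner_diff_left prod_basis_enum[of "\<lambda>b. u \<bullet> b - l \<bullet> b"])
  finally show "emeasure (distr lborel borel of_vec) (box l u) = (\<Prod>b\<in>Basis. (u - l) \<bullet> b)" .
qed simp

text \<open>For linear \<open>T\<close> this is the usual determinant, taken in standard
  coordinates. Later arguments reach it through multiplicativity (\<open>edet_compose\<close>),
  continuity and the diagonal case (\<open>edet_diag\<close>).\<close>

definition edet :: "('a::euclidean_space \<Rightarrow> 'a) \<Rightarrow> real" where
  "edet T = det (matrix (\<lambda>v. to_vec (T (of_vec v))))"

lemma edet_compose:
  assumes "linear S" "linear T"
  shows "edet (\<lambda>x. S (T x)) = edet S * edet T"
proof -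
  have S: "linear (\<lambda>v. to_vec (S (of_vec v)))" and T: "linear (\<lambda>v. to_vec (T (of_vec v)))"
    using linear_compose[OF linear_compose[OF linear_of_vec assms(1)] linear_to_vec]
      linear_compose[OF linear_compose[OF linear_of_vec assms(2)] linear_to_vec] by (simp_all add: o_def)
  show ?thesis
    using matrix_compose[OF T S] by (simp add: edet_def o_def flip: det_mul)
qed

lemma edet_id: "edet (\<lambda>x. x) = 1"
  by (simp add: edet_def matrix_id_mat_1[unfolded id_def])

text \<open>It is enough that the measure with density
  \<open>\<bar>det (matrix (T' x))\<bar>\<close> is pushed forward by \<open>T\<close> to Lebesgue
  measure, and this can be tested on boxes.\<close>

lemma nn_integral_change_of_variables_vec:
  fixes T :: "real^'n::{finite,wellorder} \<Rightarrow> real^'n::_"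
  assumes T: "\<And>x. (T has_derivative T' x) (at x)" and bij: "bij T"
    and meas [measurable]: "(\<lambda>x. det (matrix (T' x))) \<in> borel_measurable borel"
    and h [measurable]: "h \<in> borel_measurable borel"
  shows "(\<integral>\<^sup>+x. h (T x) * ennreal \<bar>det (matrix (T' x))\<bar> \<partial>lborel) = (\<integral>\<^sup>+x. h x \<partial>lborel)"
proof -
  have "continuous_on UNIV T"
    using T by (meson continuous_at_imp_continuous_on has_derivative_continuous)
  then have [measurable]: "T \<in> borel_measurable borel" by (rule borel_measurable_continuous_onI)
  have "lborel = distr (density lborel (\<lambda>x. ennreal \<bar>det (matrix (T' x))\<bar>)) borel T"
  proof (rule lborel_eqI)
    fix l u :: "real^'n::{finite,wellorder}" assume lu: "\<And>b. b \<in> Basis \<Longrightarrow> l \<bullet> b \<le> u \<bullet> b"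
    let ?S = "T -` box l u"
    have S [measurable]: "?S \<in> sets borel"
      using measurable_sets_borel[of T borel "box l u"] by simp
    have img: "T ` ?S = box l u"
      using bij by (simp add: bij_is_surj surj_image_vimage_eq)
    \<comment> \<open>The formula for the measure of a differentiable image is read backwards: the
      image of \<open>?S\<close> is the box itself, whose measure is known, and the integral of the
      Jacobian over \<open>?S\<close> follows.\<close>
    have "((\<lambda>x. \<bar>det (matrix (T' x))\<bar>) has_integral measure lebesgue (box l u)) ?S"
    proof (rule has_measure_differentiable_image[THEN iffD1])
      show "T ` ?S \<in> lmeasurable \<and> measure lebesgue (T ` ?S) = measure lebesgue (box l u)"
        by (simp only: img) simp
      show "inj_on T ?S"
        using bij by (meson bij_is_inj inj_on_subset subset_UNIV)
    qed (use S T in \<open>auto intro: has_derivative_at_withinI\<close>)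
    then have "((\<lambda>x. indicator ?S x * \<bar>det (matrix (T' x))\<bar>) has_integral measure lebesgue (box l u)) UNIV"
      by (subst (asm) has_integral_restrict_UNIV[symmetric]) (erule has_integral_eq[rotated], simp)
    then have "(\<integral>\<^sup>+x. ennreal (indicator ?S x * \<bar>det (matrix (T' x))\<bar>) \<partial>lborel) = measure lebesgue (box l u)"
      by (intro nn_integral_has_integral_lborel) (auto)
    moreover have "emeasure (distr (density lborel (\<lambda>x. ennreal \<bar>det (matrix (T' x))\<bar>)) borel T) (box l u)
       = (\<integral>\<^sup>+x. ennreal (indicator ?S x * \<bar>det (matrix (T' x))\<bar>) \<partial>lborel)"
      by (simp add: emeasure_distr emeasure_density S, intro nn_integral_cong)
        (auto simp: indicator_def)
    ultimately show "emeasure (distr (density lborel (\<lambda>x. ennreal \<bar>det (matrix (T' x))\<bar>)) borel T) (box l u)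
       = ennreal (\<Prod>b\<in>Basis. (u - l) \<bullet> b)"
      using lu by (simp add: measure_lborel_box_eq)
  qed simp
  then have "(\<integral>\<^sup>+x. h x \<partial>lborel) = (\<integral>\<^sup>+x. h x \<partial>distr (density lborel (\<lambda>x. ennreal \<bar>det (matrix (T' x))\<bar>)) borel T)"
    by simp
  also have "\<dots> = (\<integral>\<^sup>+x. h (T x) * ennreal \<bar>det (matrix (T' x))\<bar> \<partial>lborel)"
    by (simp add: nn_integral_distr nn_integral_density mult.commute)
  finally show ?thesis by simp
qed

text \<open>Conjugation with the coordinate maps reduces this to the vector case, and
  \<open>edet\<close> is by definition the Jacobian of the conjugated map.\<close>

lemma nn_integral_change_of_variables:
  fixes T :: "'a::euclidean_space \<Rightarrow> 'a"
  assumes T: "\<And>x. (T has_derivative T' x) (at x)" and bij: "bij T"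
    and meas [measurable]: "(\<lambda>x. edet (T' x)) \<in> borel_measurable borel"
    and h [measurable]: "h \<in> borel_measurable borel"
  shows "(\<integral>\<^sup>+x. h (T x) * ennreal \<bar>edet (T' x)\<bar> \<partial>lborel) = (\<integral>\<^sup>+x. h x \<partial>lborel)"
proof -
  have "continuous_on UNIV T"
    using T by (meson continuous_at_imp_continuous_on has_derivative_continuous)
  then have [measurable]: "T \<in> borel_measurable borel" by (rule borel_measurable_continuous_onI)
  have der: "((\<lambda>v. to_vec (T (of_vec v))) has_derivative (\<lambda>v. to_vec (T' (of_vec x) (of_vec v)))) (at x)" for x
    by (rule bounded_linear.has_derivative[OF bounded_linear_to_vec])
      (rule has_derivative_compose[OF bounded_linear_imp_has_derivative[OF bounded_linear_of_vec] T])
  have b: "bij (of_vec :: _ \<Rightarrow> 'a)" "bij (to_vec :: 'a \<Rightarrow> _)"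
    by (rule o_bij[of to_vec] o_bij[of of_vec]; simp add: fun_eq_iff)+
  have bij': "bij (\<lambda>v. to_vec (T (of_vec v)))"
    using bij_comp[OF bij_comp[OF b(1) bij] b(2)] by (simp add: o_def)
  have m: "(\<lambda>x. det (matrix (\<lambda>v. to_vec (T' (of_vec x) (of_vec v))))) \<in> borel_measurable borel"
    using measurable_compose[OF borel_measurable_of_vec meas] by (simp add: edet_def)
  have "(\<integral>\<^sup>+x. h (T x) * ennreal \<bar>edet (T' x)\<bar> \<partial>lborel)
      = (\<integral>\<^sup>+x. h (T (of_vec x)) * ennreal \<bar>edet (T' (of_vec x))\<bar> \<partial>lborel)"
    by (subst lborel_eq_distr_of_vec) (simp add: nn_integral_distr)
  also have "\<dots> = (\<integral>\<^sup>+x. h (of_vec x) \<partial>lborel)"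
    using nn_integral_change_of_variables_vec[OF der bij' m, of "\<lambda>v. h (of_vec v)"] by (simp add: edet_def)
  also have "\<dots> = (\<integral>\<^sup>+x. h x \<partial>lborel)"
    by (subst lborel_eq_distr_of_vec[where 'a='a]) (simp add: nn_integral_distr)
  finally show ?thesis .
qed

section \<open>The Maurer--Cartan form in the exponential chart\<close>

lemma second_difference_mean_value:
  fixes f :: "'a::real_normed_vector \<Rightarrow> real"
  assumes D1: "\<And>x. (f has_derivative (\<lambda>v. D1 v x)) (at x)"
    and D2: "\<And>v x. (D1 v has_derivative (\<lambda>w. D2 v w x)) (at x)"
    and t: "0 < t"
  obtains \<xi> \<eta> where "0 < \<xi>" "\<xi> < t" "0 < \<eta>" "\<eta> < t"
    "f (x + t *\<^sub>R v + t *\<^sub>R w) - f (x + t *\<^sub>R v) - f (x + t *\<^sub>R w) + f x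
      = t\<^sup>2 * D2 v w (x + \<xi> *\<^sub>R v + \<eta> *\<^sub>R w)"
proof -
  have lin1: "D1 (s *\<^sub>R v) x = s * D1 v x" for s v x
    using linear_cmul[OF has_derivative_linear[OF D1]] by simp
  have lin2: "D2 v (s *\<^sub>R w) x = s * D2 v w x" for s v w x
    using linear_cmul[OF has_derivative_linear[OF D2]] by simp
  have line: "((\<lambda>s. g (y + s *\<^sub>R u)) has_real_derivative g' u (y + s *\<^sub>R u)) (at s)"
    if g: "\<And>x. (g has_derivative (\<lambda>v. g' v x)) (at x)"
      and lin: "\<And>s v x. g' (s *\<^sub>R v) x = s * g' v x"
    for g :: "'a \<Rightarrow> real" and g' y u s
    unfolding has_field_derivative_def
    by (rule has_derivative_eq_rhs[OF has_derivative_compose[where g=g, OF _ g]])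
      (auto intro!: derivative_eq_intros simp: lin mult.commute)
  \<comment> \<open>The mean value theorem is applied first in the direction \<open>v\<close>, to
    the increment of \<open>f\<close> in the direction \<open>w\<close>, and then in the direction
    \<open>w\<close>, to \<open>D1 v\<close>.\<close>
  have "\<exists>\<xi>. 0 < \<xi> \<and> \<xi> < t \<and>
      (f (x + t *\<^sub>R w + t *\<^sub>R v) - f (x + t *\<^sub>R v)) - (f (x + t *\<^sub>R w + 0 *\<^sub>R v) - f (x + 0 *\<^sub>R v))
       = (t - 0) * (D1 v (x + t *\<^sub>R w + \<xi> *\<^sub>R v) - D1 v (x + \<xi> *\<^sub>R v))"
    by (rule MVT2[OF t]) (auto intro!: DERIV_diff line D1 lin1)
  then obtain \<xi> where \<xi>: "0 < \<xi>" "\<xi> < t" and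
    e1: "(f (x + t *\<^sub>R w + t *\<^sub>R v) - f (x + t *\<^sub>R v)) - (f (x + t *\<^sub>R w + 0 *\<^sub>R v) - f (x + 0 *\<^sub>R v))
       = (t - 0) * (D1 v (x + t *\<^sub>R w + \<xi> *\<^sub>R v) - D1 v (x + \<xi> *\<^sub>R v))" by blast
  have "\<exists>\<eta>. 0 < \<eta> \<and> \<eta> < t \<and> D1 v (x + \<xi> *\<^sub>R v + t *\<^sub>R w) - D1 v (x + \<xi> *\<^sub>R v + 0 *\<^sub>R w)
      = (t - 0) * D2 v w (x + \<xi> *\<^sub>R v + \<eta> *\<^sub>R w)"
    by (rule MVT2[OF t]) (auto intro!: line D2 lin2)
  then obtain \<eta> where \<eta>: "0 < \<eta>" "\<eta> < t" and
    e2: "D1 v (x + \<xi> *\<^sub>R v + t *\<^sub>R w) - D1 v (x + \<xi> *\<^sub>R v + 0 *\<^sub>R w)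
      = (t - 0) * D2 v w (x + \<xi> *\<^sub>R v + \<eta> *\<^sub>R w)" by blast
  from e1 e2 \<xi> \<eta> show thesis
    by (intro that[of \<xi> \<eta>]) (simp_all add: algebra_simps power2_eq_square)
qed

text \<open>The second difference does not change when \<open>v\<close> and \<open>w\<close> are
  swapped. Evaluating it both ways with step \<open>t n\<close> equates the two mixed derivatives at
  points \<open>p n\<close> and \<open>q n\<close> that converge to \<open>x\<close>, and continuity
  passes to the limit.\<close>

lemma second_derivative_symmetric_real:
  fixes f :: "'a::real_normed_vector \<Rightarrow> real"
  assumes D1: "\<And>x. (f has_derivative (\<lambda>v. D1 v x)) (at x)"
    and D2: "\<And>v x. (D1 v has_derivative (\<lambda>w. D2 v w x)) (at x)"
    and cont: "\<And>v w. continuous (at x) (D2 v w)"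
  shows "D2 v w x = D2 w v x"
proof -
  define t where "t n = inverse (real (Suc n))" for n
  have t: "0 < t n" for n by (simp add: t_def)
  have t0: "t \<longlonglongrightarrow> 0"
    using LIMSEQ_inverse_real_of_nat by (simp add: t_def[abs_def])
  have ex: "\<exists>p. (\<forall>n. dist (p n) x \<le> t n * (norm v + norm w) \<and>
      f (x + t n *\<^sub>R v + t n *\<^sub>R w) - f (x + t n *\<^sub>R v) - f (x + t n *\<^sub>R w) + f x
       = (t n)\<^sup>2 * D2 v w (p n))" for v w
  proof (intro choice allI)
    fix n
    obtain \<xi> \<eta> where "0 < \<xi>" "\<xi> < t n" "0 < \<eta>" "\<eta> < t n" and
      e: "f (x + t n *\<^sub>R v + t n *\<^sub>R w) - f (x + t n *\<^sub>R v) - f (x + t n *\<^sub>R w) + f x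
        = (t n)\<^sup>2 * D2 v w (x + \<xi> *\<^sub>R v + \<eta> *\<^sub>R w)"
      using second_difference_mean_value[OF D1 D2 t] by blast
    then have "norm (\<xi> *\<^sub>R v) \<le> t n * norm v" "norm (\<eta> *\<^sub>R w) \<le> t n * norm w"
      by (auto intro: mult_right_mono)
    then have "dist (x + \<xi> *\<^sub>R v + \<eta> *\<^sub>R w) x \<le> t n * (norm v + norm w)"
      unfolding dist_norm using norm_triangle_ineq[of "\<xi> *\<^sub>R v" "\<eta> *\<^sub>R w"]
      by (simp add: algebra_simps)
    with e show "\<exists>p. dist p x \<le> t n * (norm v + norm w) \<and>
      f (x + t n *\<^sub>R v + t n *\<^sub>R w) - f (x + t n *\<^sub>R v) - f (x + t n *\<^sub>R w) + f x = (t n)\<^sup>2 * D2 v w p"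
      by blast
  qed
  obtain p where p: "\<And>n. dist (p n) x \<le> t n * (norm v + norm w)"
    "\<And>n. f (x + t n *\<^sub>R v + t n *\<^sub>R w) - f (x + t n *\<^sub>R v) - f (x + t n *\<^sub>R w) + f x = (t n)\<^sup>2 * D2 v w (p n)"
    using ex[of v w] by blast
  obtain q where q: "\<And>n. dist (q n) x \<le> t n * (norm w + norm v)"
    "\<And>n. f (x + t n *\<^sub>R w + t n *\<^sub>R v) - f (x + t n *\<^sub>R w) - f (x + t n *\<^sub>R v) + f x = (t n)\<^sup>2 * D2 w v (q n)"
    using ex[of w v] by blast
  have lim: "r \<longlonglongrightarrow> x" if "\<And>n. dist (r n) x \<le> t n * c" for r c
  proof (rule metric_tendsto_imp_tendsto[OF tendsto_mult_left_zero[OF t0, of c]])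
    have "dist (r n) x \<le> dist (t n * c) 0" for n
      using that[of n] by (simp add: dist_real_def)
    then show "\<forall>\<^sub>F n in sequentially. dist (r n) x \<le> dist (t n * c) 0" by simp
  qed
  have "D2 v w (p n) = D2 w v (q n)" for n
  proof -
    have "(t n)\<^sup>2 * D2 v w (p n) = (t n)\<^sup>2 * D2 w v (q n)"
      unfolding p(2)[symmetric] q(2)[symmetric] by (simp add: algebra_simps)
    then show ?thesis using t[of n] by simp
  qed
  moreover have "(\<lambda>n. D2 v w (p n)) \<longlonglongrightarrow> D2 v w x"
    by (rule continuous_within_tendsto_compose'[OF cont _ lim[OF p(1)]]) simp
  moreover have "(\<lambda>n. D2 w v (q n)) \<longlonglongrightarrow> D2 w v x"
    by (rule continuous_within_tendsto_compose'[OF cont _ lim[OF q(1)]]) simp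
  ultimately show ?thesis by (simp only: LIMSEQ_unique)
qed

lemma smooth_has_derivative:
  "smooth f \<Longrightarrow> (f has_derivative frechet_derivative f (at x)) (at x)"
  by (metis C_k.simps(2) frechet_derivative_works smooth_def)

lemma smooth_frechet_derivative:
  "smooth f \<Longrightarrow> smooth (\<lambda>x. frechet_derivative f (at x) v)"
  by (metis C_k.simps(2) smooth_def)

lemma smooth_continuous_on: "smooth f \<Longrightarrow> continuous_on S f"
  by (metis C_k.simps(1) continuous_on_subset smooth_def subset_UNIV)

lemma frechet_derivative_symmetric:
  fixes f :: "'a::euclidean_space \<Rightarrow> 'b::euclidean_space"
  assumes f: "smooth f"
  shows "frechet_derivative (\<lambda>x. frechet_derivative f (at x) v) (at x) w
       = frechet_derivative (\<lambda>x. frechet_derivative f (at x) w) (at x) v"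
proof (rule euclidean_eqI)
  fix b :: 'b assume "b \<in> Basis"
  let ?D = "\<lambda>v x. frechet_derivative f (at x) v"
  note D = smooth_frechet_derivative[OF f]
  show "frechet_derivative (?D v) (at x) w \<bullet> b = frechet_derivative (?D w) (at x) v \<bullet> b"
  proof (rule second_derivative_symmetric_real[where f="\<lambda>x. f x \<bullet> b"
        and ?D1.0="\<lambda>v x. ?D v x \<bullet> b"
        and ?D2.0="\<lambda>v w x. frechet_derivative (?D v) (at x) w \<bullet> b"])
    show "((\<lambda>x. f x \<bullet> b) has_derivative (\<lambda>v. ?D v x \<bullet> b)) (at x)" for x
      by (intro has_derivative_inner_left smooth_has_derivative f)
    show "((\<lambda>x. ?D v x \<bullet> b) has_derivative (\<lambda>w. frechet_derivative (?D v) (at x) w \<bullet> b)) (at x)" for v x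
      by (intro has_derivative_inner_left smooth_has_derivative D)
    show "continuous (at x) (\<lambda>x. frechet_derivative (?D v) (at x) w \<bullet> b)" for v w
      using smooth_continuous_on[OF smooth_frechet_derivative[OF D[of v], of w], of UNIV]
      by (intro continuous_intros) (simp add: continuous_on_eq_continuous_at)
  qed
qed

text \<open>A product rule for the case where the derivative of the operator \<open>T p\<close> is
  known only on one fixed vector at a time. Expanding \<open>h p\<close> in the finite basis reduces
  it to the rule for scalar multiples.\<close>

lemma has_derivative_linear_apply:
  fixes T :: "'a::euclidean_space \<Rightarrow> 'b::euclidean_space \<Rightarrow> 'c::real_normed_vector"
  assumes T: "\<And>v. ((\<lambda>p. T p v) has_derivative T' v) (at x)"
    and lin: "\<And>p. linear (T p)"
    and h: "(h has_derivative h') (at x)"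
  shows "((\<lambda>p. T p (h p)) has_derivative (\<lambda>y. T' (h x) y + T x (h' y))) (at x)"
proof -
  have expand: "T p v = (\<Sum>b\<in>Basis. (v \<bullet> b) *\<^sub>R T p b)" for p v
    using linear_sum[OF lin[of p], of "\<lambda>b. (v \<bullet> b) *\<^sub>R b" Basis]
    by (simp add: euclidean_representation linear_cmul[OF lin])
  have T': "T' v y = (\<Sum>b\<in>Basis. (v \<bullet> b) *\<^sub>R T' b y)" for v y
  proof -
    have "((\<lambda>p. \<Sum>b\<in>Basis. (v \<bullet> b) *\<^sub>R T p b) has_derivative (\<lambda>y. \<Sum>b\<in>Basis. (v \<bullet> b) *\<^sub>R T' b y)) (at x)"
      by (intro has_derivative_sum has_derivative_scaleR_right T)
    then have "((\<lambda>p. T p v) has_derivative (\<lambda>y. \<Sum>b\<in>Basis. (v \<bullet> b) *\<^sub>R T' b y)) (at x)"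
      by (subst expand)
    from has_derivative_unique[OF T this] show ?thesis by metis
  qed
  have "((\<lambda>p. \<Sum>b\<in>Basis. (h p \<bullet> b) *\<^sub>R T p b) has_derivative
      (\<lambda>y. \<Sum>b\<in>Basis. (h x \<bullet> b) *\<^sub>R T' b y + (h' y \<bullet> b) *\<^sub>R T x b)) (at x)"
    by (intro has_derivative_sum has_derivative_scaleR T has_derivative_inner_left h)
  then show ?thesis
    by (simp add: expand[symmetric] T'[symmetric] sum.distrib)
qed

section \<open>The group law and left translations in exponential coordinates\<close>

context exponential_lie_group
begin

definition mult :: "'a \<Rightarrow> 'a \<Rightarrow> 'a" where
  "mult x y = inv expG (expG x + expG y)"

lemma exp_log [simp]: "expG (inv expG x) = x"
  by (rule surj_f_inv_f[OF bij_is_surj[OF bij_exp]])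

lemma log_exp [simp]: "inv expG (expG x) = x"
  by (rule inv_f_f[OF bij_is_inj[OF bij_exp]])

lemma exp_0 [simp]: "expG 0 = 0"
proof -
  have "expG 0 + expG 0 = expG 0 + 0"
    by (rule trans[OF one_parameter[of 0 0 0, unfolded scaleR_zero_right, symmetric] add_0_right[symmetric]])
  then show ?thesis by (rule add_left_imp_eq)
qed

lemma log_0 [simp]: "inv expG 0 = 0"
  using log_exp[of 0] by (simp only: exp_0)

lemma exp_minus: "expG (- x) = - expG x"
proof -
  have "expG (- x) + expG x = expG ((-1) *\<^sub>R x) + expG (1 *\<^sub>R x)"
    by (simp only: scaleR_minus1_left scaleR_one)
  also have "\<dots> = 0"
    by (simp only: one_parameter[symmetric] add.left_inverse scaleR_zero_left exp_0)
  finally show ?thesis by (simp only: eq_neg_iff_add_eq_0)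
qed

lemma exp_mult: "expG (mult x y) = expG x + expG y"
  by (simp add: mult_def)

lemma mult_assoc: "mult (mult x y) z = mult x (mult y z)"
  by (simp add: mult_def add.assoc)

lemma mult_0 [simp]: "mult 0 x = x" "mult x 0 = x"
  by (simp_all add: mult_def)

lemma mult_minus [simp]: "mult (- x) x = 0" "mult x (- x) = 0"
  by (simp_all add: mult_def exp_minus)

lemma mult_minus_cancel [simp]: "mult (- x) (mult x y) = y" "mult x (mult (- x) y) = y"
  by (simp_all add: mult_assoc[symmetric])

lemma mult_line: "mult (s *\<^sub>R x) (t *\<^sub>R x) = (s + t) *\<^sub>R x"
  by (metis mult_def one_parameter log_exp)

lemma minus_mult: "- mult x y = mult (- y) (- x)"
proof -
  have "expG (- mult x y) = expG (mult (- y) (- x))"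
    by (simp only: exp_minus exp_mult minus_add)
  then show ?thesis by (metis log_exp)
qed

definition dmult :: "'a \<times> 'a \<Rightarrow> 'a \<times> 'a \<Rightarrow> 'a" where
  "dmult z v = frechet_derivative (\<lambda>p. mult (fst p) (snd p)) (at z) v"

definition d2mult :: "'a \<times> 'a \<Rightarrow> 'a \<times> 'a \<Rightarrow> 'a \<times> 'a \<Rightarrow> 'a" where
  "d2mult z v w = frechet_derivative (\<lambda>z. dmult z v) (at z) w"

lemma smooth_mult': "smooth (\<lambda>p. mult (fst p) (snd p))"
  using smooth_mult by (simp add: mult_def)

lemma mult_has_derivative: "((\<lambda>p. mult (fst p) (snd p)) has_derivative dmult z) (at z)"
  using smooth_has_derivative[OF smooth_mult'] by (simp add: dmult_def[abs_def])

lemma dmult_has_derivative: "((\<lambda>z. dmult z v) has_derivative d2mult z v) (at z)"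
  using smooth_has_derivative[OF smooth_frechet_derivative[OF smooth_mult']]
  by (simp add: dmult_def[abs_def] d2mult_def[abs_def])

lemma d2mult_symmetric: "d2mult z v w = d2mult z w v"
  using frechet_derivative_symmetric[OF smooth_mult'] by (simp add: dmult_def[abs_def] d2mult_def)

lemma linear_dmult: "linear (dmult z)"
  using mult_has_derivative has_derivative_linear by blast

lemma continuous_on_mult: "continuous_on UNIV (\<lambda>p. mult (fst p) (snd p))"
  by (rule smooth_continuous_on[OF smooth_mult'])

text \<open>Tangent map at \<open>q\<close> of left translation by \<open>a\<close>, obtained as a
  partial derivative of the multiplication.\<close>

definition dleft :: "'a \<Rightarrow> 'a \<Rightarrow> 'a \<Rightarrow> 'a" where
  "dleft a q W = dmult (a, q) (0, W)"

lemma linear_dleft: "linear (dleft a q)"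
  unfolding dleft_def[abs_def]
  by (rule linear_compose[OF _ linear_dmult, unfolded o_def]) (auto intro!: linearI)

lemma dleft_has_derivative: "(mult a has_derivative dleft a q) (at q)"
  unfolding dleft_def[abs_def]
  using has_derivative_compose[OF has_derivative_Pair[OF has_derivative_const has_derivative_ident] mult_has_derivative]
  by simp

lemma dleft_has_derivative2:
  "((\<lambda>q. dleft a q Z) has_derivative (\<lambda>Y. d2mult (a, q) (0, Z) (0, Y))) (at q)"
  unfolding dleft_def[abs_def]
  by (rule has_derivative_compose[OF has_derivative_Pair[OF has_derivative_const has_derivative_ident] dmult_has_derivative])

definition maurer_cartan :: "'a \<Rightarrow> 'a \<Rightarrow> 'a" where
  "maurer_cartan p W = dleft (- p) p W"

text \<open>Derivative of the form at \<open>p\<close> in the direction \<open>Y\<close>, with its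
  argument \<open>W\<close> held fixed. The pair \<open>(- Y, Y)\<close> is the velocity of
  \<open>(- p, p)\<close>: both the translation by \<open>- p\<close> and its base point
  \<open>p\<close> move.\<close>

definition dmaurer_cartan :: "'a \<Rightarrow> 'a \<Rightarrow> 'a \<Rightarrow> 'a" where
  "dmaurer_cartan W p Y = d2mult (- p, p) (0, W) (- Y, Y)"

lemma linear_maurer_cartan: "linear (maurer_cartan p)"
  using linear_dleft by (simp add: maurer_cartan_def[abs_def])

lemma maurer_cartan_has_derivative:
  "((\<lambda>p. maurer_cartan p W) has_derivative dmaurer_cartan W p) (at p)"
  unfolding maurer_cartan_def[abs_def] dleft_def dmaurer_cartan_def[abs_def]
  by (rule has_derivative_compose[OF has_derivative_Pair[OF has_derivative_minus[OF has_derivative_ident] has_derivative_ident] dmult_has_derivative])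

text \<open>Translating by \<open>a\<close> and then by the inverse of \<open>mult a q\<close> is
  translating by \<open>- q\<close>. The chain rule turns this identity into left invariance of the
  form.\<close>

lemma maurer_cartan_mult: "maurer_cartan (mult a q) (dleft a q W) = maurer_cartan q W"
proof -
  have "((\<lambda>r. mult (- mult a q) (mult a r)) has_derivative (\<lambda>W. maurer_cartan (mult a q) (dleft a q W))) (at q)"
    unfolding maurer_cartan_def by (rule has_derivative_compose[OF dleft_has_derivative dleft_has_derivative])
  moreover have "(\<lambda>r. mult (- mult a q) (mult a r)) = mult (- q)"
    by (simp add: minus_mult mult_assoc fun_eq_iff)
  ultimately show ?thesis
    using has_derivative_unique[OF _ dleft_has_derivative[of "- q" q]] unfolding maurer_cartan_def by metis
qed

lemma dleft_0 [simp]: "dleft 0 q W = W"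
proof -
  have "((\<lambda>r. r) has_derivative dleft 0 q) (at q)"
    using dleft_has_derivative[of 0 q] by (metis (no_types, lifting) ext mult_0(1))
  from has_derivative_unique[OF this has_derivative_ident] show ?thesis by metis
qed

lemma maurer_cartan_0 [simp]: "maurer_cartan 0 W = W"
  by (simp add: maurer_cartan_def)

lemma maurer_cartan_dleft: "maurer_cartan a (dleft a 0 W) = W"
  using maurer_cartan_mult[of a 0 W] by simp

lemma dleft_maurer_cartan: "dleft a 0 (maurer_cartan a W) = W"
proof -
  have "((\<lambda>r. mult a (mult (- a) r)) has_derivative (\<lambda>W. dleft a 0 (maurer_cartan a W))) (at a)"
    unfolding maurer_cartan_def
    using has_derivative_compose[OF dleft_has_derivative[of "- a" a] dleft_has_derivative[of a "mult (- a) a"]] by simp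
  then have "((\<lambda>r. r) has_derivative (\<lambda>W. dleft a 0 (maurer_cartan a W))) (at a)" by simp
  from has_derivative_unique[OF this has_derivative_ident] show ?thesis by metis
qed

text \<open>Rays are one-parameter subgroups, so translation by \<open>- p\<close> moves
  \<open>s *\<^sub>R p\<close> to \<open>(s - 1) *\<^sub>R p\<close>. The velocity of this motion at
  \<open>s = 1\<close> is \<open>p\<close>.\<close>

lemma maurer_cartan_self: "maurer_cartan p p = p"
proof -
  have "((\<lambda>s. mult (- p) (s *\<^sub>R p)) has_derivative (\<lambda>h. maurer_cartan p (h *\<^sub>R p))) (at 1)"
    unfolding maurer_cartan_def
    by (rule has_derivative_compose[where g="mult (- p)"])
      (auto intro!: derivative_eq_intros dleft_has_derivative)
  moreover have "(\<lambda>s. mult (- p) (s *\<^sub>R p)) = (\<lambda>s. (s - 1) *\<^sub>R p)"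
    using mult_line[of "-1" p] by (simp add: fun_eq_iff)
  moreover have "((\<lambda>s. (s - 1) *\<^sub>R p) has_derivative (\<lambda>h. h *\<^sub>R p)) (at 1)"
    by (auto intro!: derivative_eq_intros)
  ultimately have "(\<lambda>h. maurer_cartan p (h *\<^sub>R p)) = (\<lambda>h. h *\<^sub>R p)"
    using has_derivative_unique by metis
  from fun_cong[OF this, of 1] show ?thesis by simp
qed

lemma dmaurer_cartan_self: "dmaurer_cartan p p W + maurer_cartan p W = W"
proof -
  have "((\<lambda>p. maurer_cartan p p) has_derivative (\<lambda>W. dmaurer_cartan p p W + maurer_cartan p W)) (at p)"
    by (rule has_derivative_linear_apply[OF maurer_cartan_has_derivative linear_maurer_cartan has_derivative_ident])
  then have "((\<lambda>p. p) has_derivative (\<lambda>W. dmaurer_cartan p p W + maurer_cartan p W)) (at p)"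
    by (simp add: maurer_cartan_self)
  from has_derivative_unique[OF this has_derivative_ident] show ?thesis by metis
qed

lemma linear_dmaurer_cartan: "linear (dmaurer_cartan W p)"
  using maurer_cartan_has_derivative has_derivative_linear by blast

lemma linear_dmaurer_cartan_left: "linear (\<lambda>W. dmaurer_cartan W p Y)"
proof (rule linearI)
  fix V W :: 'a and r :: real
  have "((\<lambda>p. maurer_cartan p (V + W)) has_derivative (\<lambda>Y. dmaurer_cartan V p Y + dmaurer_cartan W p Y)) (at p)"
    unfolding linear_add[OF linear_maurer_cartan]
    by (intro has_derivative_add maurer_cartan_has_derivative)
  from has_derivative_unique[OF maurer_cartan_has_derivative this]
  show "dmaurer_cartan (V + W) p Y = dmaurer_cartan V p Y + dmaurer_cartan W p Y" by metis
  have "((\<lambda>p. maurer_cartan p (r *\<^sub>R W)) has_derivative (\<lambda>Y. r *\<^sub>R dmaurer_cartan W p Y)) (at p)"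
    unfolding linear_cmul[OF linear_maurer_cartan]
    by (intro has_derivative_scaleR_right maurer_cartan_has_derivative)
  from has_derivative_unique[OF maurer_cartan_has_derivative this]
  show "dmaurer_cartan (r *\<^sub>R W) p Y = r *\<^sub>R dmaurer_cartan W p Y" by metis
qed

text \<open>The bracket involves the derivatives at the unit of the fields
  \<open>dleft p 0 Z\<close>. Differentiating the constant
  \<open>maurer_cartan p (dleft p 0 Z)\<close> expresses them through the derivative of the form,
  with the opposite sign.\<close>

lemma lie_bracket_eq: "lie_bracket expG X Y = dmaurer_cartan X 0 Y - dmaurer_cartan Y 0 X"
proof -
  have field: "left_invariant_field expG X = (\<lambda>p. dleft p 0 X)" for X
    by (simp add: left_invariant_field_def[abs_def] fun_eq_iff mult_def[symmetric]
        frechet_derivative_at[OF dleft_has_derivative, symmetric])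
  have der: "((\<lambda>p. dleft p 0 Z) has_derivative (\<lambda>Y. - dmaurer_cartan Z 0 Y)) (at 0)" for Z
  proof -
    have d: "((\<lambda>p. dleft p 0 Z) has_derivative (\<lambda>Y. d2mult (0, 0) (0, Z) (Y, 0))) (at 0)"
      unfolding dleft_def[abs_def]
      by (rule has_derivative_compose[OF has_derivative_Pair[OF has_derivative_ident has_derivative_const] dmult_has_derivative])
    have "((\<lambda>p. maurer_cartan p (dleft p 0 Z)) has_derivative
        (\<lambda>Y. dmaurer_cartan (dleft 0 0 Z) 0 Y + maurer_cartan 0 (d2mult (0, 0) (0, Z) (Y, 0)))) (at 0)"
      by (rule has_derivative_linear_apply[OF maurer_cartan_has_derivative linear_maurer_cartan d])
    then have "((\<lambda>p. Z) has_derivative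
        (\<lambda>Y. dmaurer_cartan Z 0 Y + d2mult (0, 0) (0, Z) (Y, 0))) (at (0 :: 'a))"
      by (simp add: maurer_cartan_dleft)
    then have "(\<lambda>Y. dmaurer_cartan Z 0 Y + d2mult (0, 0) (0, Z) (Y, 0)) = (\<lambda>Y. 0)"
      by (rule has_derivative_unique) simp
    then have "d2mult (0, 0) (0, Z) (Y, 0) = - dmaurer_cartan Z 0 Y" for Y
      by (metis minus_unique)
    with d show ?thesis by simp
  qed
  show ?thesis
    by (simp add: lie_bracket_def field_bracket_def field frechet_derivative_at[OF der, symmetric])
qed

lemma linear_lie_bracket: "linear (lie_bracket expG X)"
  unfolding lie_bracket_eq[abs_def]
  by (intro linear_compose_sub linear_dmaurer_cartan linear_dmaurer_cartan_left)

text \<open>Left invariance of the form is differentiated at the unit. A second derivative of left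
  translation appears; it is symmetric and cancels after antisymmetrising, which leaves the bracket
  at the unit.\<close>

lemma maurer_cartan_equation:
  "dmaurer_cartan V p W - dmaurer_cartan W p V
    = lie_bracket expG (maurer_cartan p V) (maurer_cartan p W)"
proof -
  have *: "dmaurer_cartan (dleft p 0 Z) p (dleft p 0 Y)
      + maurer_cartan p (d2mult (p, 0) (0, Z) (0, Y)) = dmaurer_cartan Z 0 Y" for Y Z
  proof -
    have "((\<lambda>q. maurer_cartan (mult p q) (dleft p q Z)) has_derivative
        (\<lambda>Y. dmaurer_cartan (dleft p 0 Z) p (dleft p 0 Y)
            + maurer_cartan (mult p 0) (d2mult (p, 0) (0, Z) (0, Y)))) (at 0)"
    proof (rule has_derivative_linear_apply[OF _ linear_maurer_cartan dleft_has_derivative2])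
      show "((\<lambda>q. maurer_cartan (mult p q) v) has_derivative (\<lambda>Y. dmaurer_cartan v p (dleft p 0 Y))) (at 0)" for v
        using has_derivative_compose[OF dleft_has_derivative[of p 0] maurer_cartan_has_derivative[of v "mult p 0"]] by simp
    qed
    then have "((\<lambda>q. maurer_cartan q Z) has_derivative
        (\<lambda>Y. dmaurer_cartan (dleft p 0 Z) p (dleft p 0 Y)
            + maurer_cartan p (d2mult (p, 0) (0, Z) (0, Y)))) (at 0)"
      by (simp add: maurer_cartan_mult)
    from has_derivative_unique[OF this maurer_cartan_has_derivative] show ?thesis by metis
  qed
  have "dmaurer_cartan (dleft p 0 Z) p (dleft p 0 Y) - dmaurer_cartan (dleft p 0 Y) p (dleft p 0 Z)
      = dmaurer_cartan Z 0 Y - dmaurer_cartan Y 0 Z" for Y Z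
    unfolding *[of Z Y, symmetric] *[of Y Z, symmetric] d2mult_symmetric[of "(p, 0)" "(0, Z)" "(0, Y)"]
    by simp
  \<comment> \<open>Every vector at \<open>p\<close> is the left translate of its own value under
    the form.\<close>
  from this[of "maurer_cartan p V" "maurer_cartan p W"] show ?thesis
    by (simp add: dleft_maurer_cartan lie_bracket_eq)
qed

text \<open>A linear equation in which the group enters only through its bracket. Its solution is
  therefore natural under Lie algebra morphisms, which replaces lifting them to the group.\<close>

lemma maurer_cartan_ode:
  "((\<lambda>t. t *\<^sub>R maurer_cartan (t *\<^sub>R X) W) has_vector_derivative
     W - lie_bracket expG X (t *\<^sub>R maurer_cartan (t *\<^sub>R X) W)) (at t)"
proof -
  have "((\<lambda>t. maurer_cartan (t *\<^sub>R X) W) has_derivative (\<lambda>h. dmaurer_cartan W (t *\<^sub>R X) (h *\<^sub>R X))) (at t)"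
    by (rule has_derivative_compose[where g="\<lambda>p. maurer_cartan p W"])
      (auto intro!: derivative_eq_intros maurer_cartan_has_derivative)
  then have "((\<lambda>t. maurer_cartan (t *\<^sub>R X) W) has_vector_derivative dmaurer_cartan W (t *\<^sub>R X) X) (at t)"
    by (simp add: has_vector_derivative_def linear_cmul[OF linear_dmaurer_cartan])
  then have "((\<lambda>t. t *\<^sub>R maurer_cartan (t *\<^sub>R X) W) has_vector_derivative
      t *\<^sub>R dmaurer_cartan W (t *\<^sub>R X) X + 1 *\<^sub>R maurer_cartan (t *\<^sub>R X) W) (at t)"
    by (intro has_vector_derivative_scaleR) auto
  moreover have "t *\<^sub>R dmaurer_cartan W (t *\<^sub>R X) X + 1 *\<^sub>R maurer_cartan (t *\<^sub>R X) W
      = W - lie_bracket expG X (t *\<^sub>R maurer_cartan (t *\<^sub>R X) W)"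
  proof (cases "t = 0")
    case False
    \<comment> \<open>The form fixes the radial direction, so the Maurer-Cartan equation with
      \<open>X\<close> as one argument produces the bracket with \<open>X\<close> itself. Dividing
      by \<open>t\<close> is what forces the case distinction.\<close>
    have "maurer_cartan (t *\<^sub>R X) X = X"
      using maurer_cartan_self[of "t *\<^sub>R X"] False by (simp add: linear_cmul[OF linear_maurer_cartan])
    then have "t *\<^sub>R (dmaurer_cartan X (t *\<^sub>R X) W - dmaurer_cartan W (t *\<^sub>R X) X)
        = lie_bracket expG X (t *\<^sub>R maurer_cartan (t *\<^sub>R X) W)"
      by (simp add: maurer_cartan_equation linear_cmul[OF linear_lie_bracket])
    moreover have "t *\<^sub>R dmaurer_cartan X (t *\<^sub>R X) W = W - maurer_cartan (t *\<^sub>R X) W"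
      using dmaurer_cartan_self[of "t *\<^sub>R X" W]
      by (simp add: linear_cmul[OF linear_dmaurer_cartan_left] eq_diff_eq)
    ultimately show ?thesis by (simp add: scaleR_diff_right algebra_simps)
  qed (simp add: linear_0[OF linear_lie_bracket])
  ultimately show ?thesis by simp
qed

end

text \<open>Gronwall's argument: if \<open>K\<close> bounds \<open>L\<close>, the squared norm of
  \<open>e t\<close> times \<open>exp (- 2 * K * t)\<close> has nonpositive derivative, starts at 0
  and is nonnegative.\<close>

lemma linear_ode_zero:
  fixes e :: "real \<Rightarrow> 'a::euclidean_space"
  assumes L: "linear L" and e: "\<And>t. (e has_vector_derivative L (e t)) (at t)" and e0: "e 0 = 0"
    and t: "0 \<le> t"
  shows "e t = 0"
proof -
  obtain K where K: "\<And>x. norm (L x) \<le> norm x * K"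
    using bounded_linear.bounded[OF linear_conv_bounded_linear[THEN iffD1, OF L]] by blast
  have der: "((\<lambda>t. (e t \<bullet> e t) * exp (- 2 * K * t)) has_real_derivative
      (2 * (e t \<bullet> L (e t)) - 2 * K * (e t \<bullet> e t)) * exp (- 2 * K * t)) (at t)" for t
  proof -
    have "((\<lambda>t. e t \<bullet> e t) has_derivative (\<lambda>h. e t \<bullet> (h *\<^sub>R L (e t)) + (h *\<^sub>R L (e t)) \<bullet> e t)) (at t)"
      using e[of t] unfolding has_vector_derivative_def by (intro has_derivative_inner)
    then have "((\<lambda>t. e t \<bullet> e t) has_real_derivative 2 * (e t \<bullet> L (e t))) (at t)"
      unfolding has_field_derivative_def
      by (rule has_derivative_eq_rhs) (simp add: fun_eq_iff inner_commute)
    then show ?thesis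
      by (auto intro!: derivative_eq_intros simp: algebra_simps)
  qed
  have "e s \<bullet> L (e s) \<le> K * (e s \<bullet> e s)" for s
    using order_trans[OF Cauchy_Schwarz_ineq2[of "e s" "L (e s)", THEN abs_le_D1] mult_left_mono[OF K[of "e s"] norm_ge_zero[of "e s"]]]
    by (simp add: dot_square_norm power2_eq_square mult_ac)
  then have "(e t \<bullet> e t) * exp (- 2 * K * t) \<le> (e 0 \<bullet> e 0) * exp (- 2 * K * 0)"
    using der by (intro DERIV_nonpos_imp_nonincreasing[OF t])
      (force simp: mult_le_0_iff)
  then have "e t \<bullet> e t \<le> 0" by (simp add: e0 mult_le_0_iff)
  then show ?thesis by (metis inner_eq_zero_iff inner_ge_zero order_antisym)
qed

context exponential_lie_group
begin

text \<open>The curves \<open>T (s X W t)\<close> and \<open>s (T X) (T W) t\<close> both start at 0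
  and solve the same linear equation, since \<open>T\<close> respects the bracket. Their difference
  \<open>e\<close> vanishes at time 1.\<close>

lemma maurer_cartan_morphism:
  assumes "lie_algebra_morphism expG T"
  shows "T (maurer_cartan X W) = maurer_cartan (T X) (T W)"
proof -
  have T: "linear T" and TB: "\<And>X Y. T (lie_bracket expG X Y) = lie_bracket expG (T X) (T Y)"
    using assms by (auto simp: lie_algebra_morphism_def)
  define s where "s X W t = t *\<^sub>R maurer_cartan (t *\<^sub>R X) W" for X W t
  define e where "e t = T (s X W t) - s (T X) (T W) t" for t
  have "e 1 = 0"
  proof (rule linear_ode_zero)
    show "linear (\<lambda>Y. - lie_bracket expG (T X) Y)"
      by (intro linear_compose_neg linear_lie_bracket)
    show "(e has_vector_derivative - lie_bracket expG (T X) (e t)) (at t)" for t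
    proof -
      have s: "(s X W has_vector_derivative W - lie_bracket expG X (s X W t)) (at t)" for X W
        using maurer_cartan_ode[of X W t] by (simp add: s_def[abs_def])
      have "((\<lambda>t. T (s X W t)) has_vector_derivative T (W - lie_bracket expG X (s X W t))) (at t)"
        by (rule bounded_linear.has_vector_derivative[OF linear_conv_bounded_linear[THEN iffD1, OF T] s])
      from has_vector_derivative_diff[OF this s[of "T X" "T W"]] show ?thesis
        unfolding e_def[abs_def]
        by (simp add: linear_diff[OF T] linear_diff[OF linear_lie_bracket] TB)
    qed
  qed (auto simp: e_def s_def linear_0[OF T])
  then show ?thesis by (simp add: e_def s_def)
qed

end

section \<open>Uniqueness and scaling of Haar measure\<close>

lemma continuous_on_edet:
  fixes T :: "'a::euclidean_space \<Rightarrow> 'b::euclidean_space \<Rightarrow> 'b"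
  assumes "\<And>v. continuous_on S (\<lambda>p. T p v)"
  shows "continuous_on S (\<lambda>p. edet (T p))"
proof -
  have "continuous_on S (\<lambda>p. to_vec (T p v))" for v
    by (rule continuous_on_compose2[OF linear_continuous_on[OF bounded_linear_to_vec, of UNIV] assms subset_UNIV])
  then show ?thesis
    unfolding edet_def det_def matrix_def by (simp, intro continuous_intros)
qed

context exponential_lie_group
begin

definition jacobian :: "'a \<Rightarrow> real" where
  "jacobian p = edet (maurer_cartan p)"

lemma continuous_on_jacobian: "continuous_on S jacobian"
  unfolding jacobian_def[abs_def]
  by (rule continuous_on_edet, rule has_derivative_continuous_on, rule has_derivative_at_withinI,
      rule maurer_cartan_has_derivative)

lemma borel_measurable_jacobian [measurable]: "jacobian \<in> borel_measurable borel"
  by (intro borel_measurable_continuous_onI continuous_on_jacobian)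

text \<open>Determinants are taken in \<open>maurer_cartan_mult\<close>; the result is the
  transformation rule of a left-invariant density.\<close>

lemma jacobian_mult: "jacobian (mult a q) * edet (dleft a q) = jacobian q"
  unfolding jacobian_def edet_compose[OF linear_maurer_cartan linear_dleft, symmetric]
  by (simp add: maurer_cartan_mult)

lemma jacobian_nonzero: "jacobian p \<noteq> 0"
proof -
  have "maurer_cartan 0 = (\<lambda>W. W)" by (simp add: fun_eq_iff)
  then show ?thesis
    using jacobian_mult[of p 0] by (auto simp: jacobian_def edet_id)
qed

text \<open>By \<open>maurer_cartan_morphism\<close>, \<open>T\<close> intertwines the form at
  \<open>X\<close> with the form at \<open>T X\<close>. The determinant of \<open>T\<close> occurs
  on both sides and cancels.\<close>

lemma jacobian_morphism:
  assumes T: "lie_algebra_morphism expG T" and det: "edet T \<noteq> 0"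
  shows "jacobian (T X) = jacobian X"
proof -
  have lin: "linear T" using T by (simp add: lie_algebra_morphism_def)
  have "edet T * jacobian X = jacobian (T X) * edet T"
    unfolding jacobian_def edet_compose[OF lin linear_maurer_cartan, symmetric]
      edet_compose[OF linear_maurer_cartan lin, symmetric]
    by (simp add: maurer_cartan_morphism[OF T])
  then show ?thesis using det by simp
qed

lemma borel_measurable_mult [measurable]:
  assumes "f \<in> borel_measurable M" "g \<in> borel_measurable M"
  shows "(\<lambda>x. mult (f x) (g x)) \<in> borel_measurable M"
  by (rule borel_measurable_continuous_Pair[OF assms continuous_on_mult])

definition chart_haar :: "'a measure" where
  "chart_haar = density lborel (\<lambda>p. ennreal \<bar>jacobian p\<bar>)"

lemma sets_chart_haar [simp, measurable_cong]: "sets chart_haar = sets borel"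
  by (simp add: chart_haar_def)

lemma nn_integral_chart_haar:
  "h \<in> borel_measurable borel \<Longrightarrow> (\<integral>\<^sup>+x. h x \<partial>chart_haar) = (\<integral>\<^sup>+x. h x * ennreal \<bar>jacobian x\<bar> \<partial>lborel)"
  by (simp add: chart_haar_def nn_integral_density mult.commute)

lemma nn_integral_chart_haar_mult:
  assumes [measurable]: "h \<in> borel_measurable borel"
  shows "(\<integral>\<^sup>+x. h (mult a x) \<partial>chart_haar) = (\<integral>\<^sup>+x. h x \<partial>chart_haar)"
proof -
  have det: "edet (dleft a q) = jacobian q / jacobian (mult a q)" for q
    using jacobian_mult[of a q] jacobian_nonzero[of "mult a q"] by (simp add: field_simps)
  have "bij (mult a)"
    by (rule o_bij[of "mult (- a)"]) (simp_all add: fun_eq_iff)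
  moreover have "(\<lambda>q. edet (dleft a q)) \<in> borel_measurable borel"
    unfolding det by measurable
  moreover have "(\<lambda>x. h x * ennreal \<bar>jacobian x\<bar>) \<in> borel_measurable borel"
    by measurable
  ultimately have "(\<integral>\<^sup>+x. h (mult a x) * ennreal \<bar>jacobian (mult a x)\<bar> * ennreal \<bar>edet (dleft a x)\<bar> \<partial>lborel)
      = (\<integral>\<^sup>+x. h x * ennreal \<bar>jacobian x\<bar> \<partial>lborel)"
    using dleft_has_derivative by (intro nn_integral_change_of_variables) auto
  moreover have "ennreal \<bar>jacobian (mult a x)\<bar> * ennreal \<bar>edet (dleft a x)\<bar> = ennreal \<bar>jacobian x\<bar>" for x
    by (simp add: jacobian_mult flip: ennreal_mult' abs_mult)
  ultimately show ?thesis
    by (simp add: nn_integral_chart_haar mult.assoc)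
qed

lemma nn_integral_chart_haar_morphism:
  assumes T: "lie_algebra_morphism expG T" and bij: "bij T" and det: "edet T \<noteq> 0"
    and [measurable]: "h \<in> borel_measurable borel"
  shows "(\<integral>\<^sup>+x. h (T x) \<partial>chart_haar) * ennreal \<bar>edet T\<bar> = (\<integral>\<^sup>+x. h x \<partial>chart_haar)"
proof -
  have bl: "bounded_linear T" using T by (simp add: lie_algebra_morphism_def linear_conv_bounded_linear)
  have [measurable]: "T \<in> borel_measurable borel"
    by (intro borel_measurable_continuous_onI linear_continuous_on bl)
  have "(\<integral>\<^sup>+x. h (T x) * ennreal \<bar>jacobian (T x)\<bar> * ennreal \<bar>edet T\<bar> \<partial>lborel)
      = (\<integral>\<^sup>+x. h x * ennreal \<bar>jacobian x\<bar> \<partial>lborel)"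
    by (intro nn_integral_change_of_variables bounded_linear_imp_has_derivative bl bij) measurable
  then show ?thesis
    by (simp add: nn_integral_chart_haar jacobian_morphism[OF T det] nn_integral_multc)
qed

text \<open>The density has no zeros, so an open null set would be Lebesgue null.\<close>

lemma chart_haar_open:
  assumes "open U" "U \<noteq> {}"
  shows "emeasure chart_haar U > 0"
proof (rule ccontr)
  assume "\<not> emeasure chart_haar U > 0"
  then have 0: "(\<integral>\<^sup>+x. indicator U x * ennreal \<bar>jacobian x\<bar> \<partial>lborel) = 0"
    using nn_integral_chart_haar[of "indicator U"] \<open>open U\<close> by (simp add: not_less)
  have "AE x in lborel. indicator U x * ennreal \<bar>jacobian x\<bar> = 0"
    using 0 \<open>open U\<close> by (subst (asm) nn_integral_0_iff_AE) auto
  then have "AE x in lborel. x \<notin> U"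
    by eventually_elim (auto simp: indicator_def jacobian_nonzero split: if_splits)
  then have "emeasure lborel U = 0"
    using \<open>open U\<close> by (subst (asm) AE_iff_measurable[of U]) auto
  then have "negligible U"
    using \<open>open U\<close> by (simp add: negligible_iff_null_sets null_sets_def)
  with assms open_not_negligible show False by blast
qed

lemma chart_haar_compact:
  assumes "compact K"
  shows "emeasure chart_haar K < \<infinity>"
proof -
  obtain C where C: "\<And>x. x \<in> K \<Longrightarrow> \<bar>jacobian x\<bar> \<le> C"
    using compact_imp_bounded[OF compact_continuous_image[OF continuous_on_jacobian assms]]
    unfolding bounded_iff by auto
  have [measurable]: "K \<in> sets borel" using assms by (simp add: borel_compact)
  have "emeasure chart_haar K = (\<integral>\<^sup>+x. indicator K x * ennreal \<bar>jacobian x\<bar> \<partial>lborel)"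
    using nn_integral_chart_haar[of "indicator K"] by simp
  also have "\<dots> \<le> (\<integral>\<^sup>+x. ennreal C * indicator K x \<partial>lborel)"
    by (intro nn_integral_mono) (auto simp: indicator_def C intro!: ennreal_leI)
  also have "\<dots> = ennreal C * emeasure lborel K"
    by (simp add: nn_integral_cmult)
  also have "\<dots> < \<infinity>"
    using emeasure_compact_finite[OF assms] by (simp add: ennreal_mult_less_top)
  finally show ?thesis .
qed

text \<open>Both sides equal the double integral of \<open>f (y\<^sup>-\<^sup>1 x) g x\<close>: the translations
  \<open>x \<mapsto> y\<^sup>-\<^sup>1 x\<close> and \<open>y \<mapsto> x y\<close> leave \<open>\<mu>\<close> and \<open>\<nu>\<close> invariant.\<close>

lemma nn_integral_left_invariant_exchange:
  fixes f g :: "'a \<Rightarrow> ennreal"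
  assumes sets [measurable_cong]: "sets \<mu> = sets borel" "sets \<nu> = sets borel"
    and "sigma_finite_measure \<mu>" "sigma_finite_measure \<nu>"
    and inv\<mu>: "\<And>a h. h \<in> borel_measurable borel \<Longrightarrow> (\<integral>\<^sup>+x. h (mult a x) \<partial>\<mu>) = (\<integral>\<^sup>+x. h x \<partial>\<mu>)"
    and inv\<nu>: "\<And>a h. h \<in> borel_measurable borel \<Longrightarrow> (\<integral>\<^sup>+x. h (mult a x) \<partial>\<nu>) = (\<integral>\<^sup>+x. h x \<partial>\<nu>)"
    and [measurable]: "f \<in> borel_measurable borel" "g \<in> borel_measurable borel"
  shows "(\<integral>\<^sup>+x. f x * (\<integral>\<^sup>+y. g (mult y x) \<partial>\<nu>) \<partial>\<mu>) = (\<integral>\<^sup>+x. g x \<partial>\<mu>) * (\<integral>\<^sup>+y. f (- y) \<partial>\<nu>)"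
proof -
  interpret \<mu>: sigma_finite_measure \<mu> by fact
  interpret \<nu>: sigma_finite_measure \<nu> by fact
  interpret pair_sigma_finite \<nu> \<mu> ..
  have "(\<integral>\<^sup>+x. f x * (\<integral>\<^sup>+y. g (mult y x) \<partial>\<nu>) \<partial>\<mu>) = (\<integral>\<^sup>+x. (\<integral>\<^sup>+y. f x * g (mult y x) \<partial>\<nu>) \<partial>\<mu>)"
    by (intro nn_integral_cong) (simp add: nn_integral_cmult)
  also have "\<dots> = (\<integral>\<^sup>+y. (\<integral>\<^sup>+x. f x * g (mult y x) \<partial>\<mu>) \<partial>\<nu>)"
    by (rule Fubini') measurable
  also have "\<dots> = (\<integral>\<^sup>+y. (\<integral>\<^sup>+x. f (mult (- y) x) * g x \<partial>\<mu>) \<partial>\<nu>)"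
  proof (rule nn_integral_cong)
    fix y
    show "(\<integral>\<^sup>+x. f x * g (mult y x) \<partial>\<mu>) = (\<integral>\<^sup>+x. f (mult (- y) x) * g x \<partial>\<mu>)"
      using inv\<mu>[of "\<lambda>x. f (mult (- y) x) * g x" y] by simp
  qed
  also have "\<dots> = (\<integral>\<^sup>+x. (\<integral>\<^sup>+y. f (mult (- y) x) * g x \<partial>\<nu>) \<partial>\<mu>)"
    by (rule Fubini'[symmetric]) measurable
  also have "\<dots> = (\<integral>\<^sup>+x. (\<integral>\<^sup>+y. f (- y) \<partial>\<nu>) * g x \<partial>\<mu>)"
  proof (rule nn_integral_cong)
    fix x
    show "(\<integral>\<^sup>+y. f (mult (- y) x) * g x \<partial>\<nu>) = (\<integral>\<^sup>+y. f (- y) \<partial>\<nu>) * g x"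
      using inv\<nu>[of "\<lambda>y. f (- y)" "- x"] by (simp add: nn_integral_multc minus_mult)
  qed
  also have "\<dots> = (\<integral>\<^sup>+x. g x \<partial>\<mu>) * (\<integral>\<^sup>+y. f (- y) \<partial>\<nu>)"
    by (subst nn_integral_cmult) (simp_all add: mult.commute)
  finally show ?thesis .
qed

end

lemma sigma_finite_measure_compact:
  fixes \<mu> :: "'a::euclidean_space measure"
  assumes sets: "sets \<mu> = sets borel" and fin: "\<And>K. compact K \<Longrightarrow> emeasure \<mu> K < \<infinity>"
  shows "sigma_finite_measure \<mu>"
proof
  have "(\<Union>n. cball 0 (real n)) = (UNIV :: 'a set)"
    using real_arch_simple by auto
  moreover have "space \<mu> = UNIV" using sets_eq_imp_space_eq[OF sets] by simp
  ultimately show "\<exists>A. countable A \<and> A \<subseteq> sets \<mu> \<and> \<Union> A = space \<mu> \<and> (\<forall>a\<in>A. emeasure \<mu> a \<noteq> \<infinity>)"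
    using fin by (intro exI[of _ "range (\<lambda>n. cball 0 (real n))"]) (auto simp: sets less_top)
qed

context exponential_lie_group
begin

text \<open>The exchange identity is used twice with the same \<open>f / h\<close> and the same
  ball, once for \<open>\<mu>\<close> and once with \<open>chart_haar\<close> in its place. Both
  right-hand sides contain the integral of \<open>f (- y) / h (- y)\<close> against
  \<open>chart_haar\<close>; eliminating it gives proportionality with an explicit constant.\<close>

lemma left_invariant_unique:
  assumes sets [measurable_cong]: "sets \<mu> = sets borel"
    and fin: "\<And>K. compact K \<Longrightarrow> emeasure \<mu> K < \<infinity>"
    and inv: "\<And>a h. h \<in> borel_measurable borel \<Longrightarrow> (\<integral>\<^sup>+x. h (mult a x) \<partial>\<mu>) = (\<integral>\<^sup>+x. h x \<partial>\<mu>)"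
    and [measurable]: "f \<in> borel_measurable borel"
  shows "emeasure chart_haar (ball 0 1) * (\<integral>\<^sup>+x. f x \<partial>\<mu>) = emeasure \<mu> (ball 0 1) * (\<integral>\<^sup>+x. f x \<partial>chart_haar)"
proof -
  interpret \<mu>: sigma_finite_measure \<mu> by (rule sigma_finite_measure_compact[OF sets fin])
  interpret \<nu>: sigma_finite_measure chart_haar
    by (rule sigma_finite_measure_compact[OF sets_chart_haar chart_haar_compact])
  let ?B = "ball 0 1 :: 'a set"
  \<comment> \<open>This is the measure of the ball translated on the right by \<open>- x\<close>.
    So far \<open>chart_haar\<close> is only left invariant, so \<open>h\<close> may vary; dividing
    \<open>f\<close> by it cancels the inner integral of the exchange identity.\<close>
  define h where "h x = (\<integral>\<^sup>+y. indicator ?B (mult y x) \<partial>chart_haar)" for x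
  have [measurable]: "h \<in> borel_measurable borel"
  proof -
    have "(\<lambda>x. \<integral>\<^sup>+y. g (mult y x) \<partial>chart_haar) \<in> borel_measurable borel"
      if [measurable]: "g \<in> borel_measurable borel" for g :: "'a \<Rightarrow> ennreal"
      by measurable
    moreover have "(indicator ?B :: 'a \<Rightarrow> ennreal) \<in> borel_measurable borel"
      by (intro borel_measurable_indicator borel_open open_ball)
    ultimately show ?thesis unfolding h_def[abs_def] by blast
  qed
  have cont: "continuous_on UNIV (\<lambda>y. mult y x)" for x
    using continuous_on_compose2[OF continuous_on_mult, of UNIV "\<lambda>y. (y, x)"]
    by (simp add: continuous_on_Pair)
  have opn: "open {y. mult y x \<in> ?B}" for x
    using open_vimage[OF open_ball cont[of x], of 0 1] unfolding vimage_def .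
  have h_eq: "h x = emeasure chart_haar {y. mult y x \<in> ?B}" for x
  proof -
    have "{y. mult y x \<in> ?B} \<in> sets borel"
      by (rule borel_open[OF opn])
    moreover have "indicator ?B (mult y x) = (indicator {y. mult y x \<in> ?B} y :: ennreal)" for y
      by (simp add: indicator_def)
    ultimately show ?thesis by (simp add: h_def)
  qed
  have cancel: "mult (mult y x) (- x) = y" "mult (mult y (- x)) x = y" for x y
    by (simp_all add: mult_assoc)
  have h_pos: "h x > 0" for x
    unfolding h_eq
  proof (rule chart_haar_open)
    show "open {y. mult y x \<in> ?B}"
      by (rule opn)
    show "{y. mult y x \<in> ?B} \<noteq> {}"
      using mult_minus(1)[of x] centre_in_ball[of 0 1] by (metis (mono_tags) empty_iff mem_Collect_eq zero_less_one)
  qed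
  have h_fin: "h x < \<infinity>" for x
  proof -
    have K: "compact ((\<lambda>y. mult y (- x)) ` cball 0 1)"
      by (intro compact_continuous_image continuous_on_subset[OF cont]) auto
    have "h x \<le> emeasure chart_haar ((\<lambda>y. mult y (- x)) ` cball 0 1)"
      unfolding h_eq
    proof (rule emeasure_mono)
      show "{y. mult y x \<in> ?B} \<subseteq> (\<lambda>y. mult y (- x)) ` cball 0 1"
      proof
        fix y assume "y \<in> {y. mult y x \<in> ?B}"
        then have "mult y x \<in> cball 0 1" using ball_subset_cball by blast
        from imageI[OF this, of "\<lambda>y. mult y (- x)"]
        show "y \<in> (\<lambda>y. mult y (- x)) ` cball 0 1" unfolding cancel .
      qed
    qed (use K in \<open>simp add: borel_compact\<close>)
    with chart_haar_compact[OF K] show ?thesis by simp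
  qed
  \<comment> \<open>Since \<open>h x\<close> is positive and finite, the cancellation is exact even
    where \<open>f x\<close> is infinite.\<close>
  have canc: "f x / h x * h x = f x" for x
    using h_pos[of x] h_fin[of x] by (simp add: ennreal_divide_times)
  have quot: "(\<lambda>x. f x / h x) \<in> borel_measurable borel"
    by measurable
  have ind: "(indicator ?B :: 'a \<Rightarrow> ennreal) \<in> borel_measurable borel"
    by (intro borel_measurable_indicator borel_open open_ball)
  have "?B \<in> sets \<mu>" "?B \<in> sets chart_haar"
    by (simp_all only: sets sets_chart_haar borel_open open_ball)
  then have emeasure_B: "(\<integral>\<^sup>+x. indicator ?B x \<partial>\<mu>) = emeasure \<mu> ?B"
    "(\<integral>\<^sup>+x. indicator ?B x \<partial>chart_haar) = emeasure chart_haar ?B"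
    by (simp_all only: nn_integral_indicator)
  have "(\<integral>\<^sup>+x. f x / h x * h x \<partial>\<mu>) = emeasure \<mu> ?B * (\<integral>\<^sup>+y. f (- y) / h (- y) \<partial>chart_haar)"
    using nn_integral_left_invariant_exchange[OF sets sets_chart_haar \<mu>.sigma_finite_measure_axioms
        \<nu>.sigma_finite_measure_axioms inv nn_integral_chart_haar_mult quot ind]
    unfolding h_def[symmetric] emeasure_B .
  moreover have "(\<integral>\<^sup>+x. f x / h x * h x \<partial>chart_haar)
      = emeasure chart_haar ?B * (\<integral>\<^sup>+y. f (- y) / h (- y) \<partial>chart_haar)"
    using nn_integral_left_invariant_exchange[OF sets_chart_haar sets_chart_haar \<nu>.sigma_finite_measure_axioms
        \<nu>.sigma_finite_measure_axioms nn_integral_chart_haar_mult nn_integral_chart_haar_mult quot ind]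
    unfolding h_def[symmetric] emeasure_B .
  ultimately show ?thesis
    unfolding canc by (metis mult.left_commute)
qed

lemma emeasure_distr_log_compact:
  assumes M: "haar_measure M" and K: "compact K"
  shows "emeasure (distr M borel (inv expG)) K < \<infinity>"
proof -
  have sets [measurable_cong]: "sets M = sets borel"
    using M by (simp add: haar_measure_def)
  have [measurable]: "inv expG \<in> borel_measurable borel"
    by (rule borel_measurable_continuous_onI[OF continuous_log])
  have "inv expG -` K = expG ` K"
    by (auto simp: image_iff) (metis exp_log)
  then have "emeasure (distr M borel (inv expG)) K = emeasure M (expG ` K)"
    using sets_eq_imp_space_eq[OF sets] borel_compact[OF K] by (simp add: emeasure_distr)
  moreover have "compact (expG ` K)"
    by (rule compact_continuous_image[OF continuous_on_subset[OF continuous_exp] K]) simp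
  ultimately show ?thesis
    using M by (simp add: haar_measure_def)
qed

text \<open>Read in the chart, \<open>M\<close> is left invariant and finite on compact sets, hence
  proportional to \<open>chart_haar\<close>, whose scaling under \<open>T\<close> carries over. The
  constant \<open>emeasure chart_haar ?B\<close> is positive and finite and cancels.\<close>

lemma nn_integral_haar_morphism:
  assumes M: "haar_measure M"
    and T: "lie_algebra_morphism expG T" and bij: "bij T" and det: "edet T \<noteq> 0"
    and [measurable]: "h \<in> borel_measurable borel"
  shows "(\<integral>\<^sup>+x. h (T x) \<partial>distr M borel (inv expG)) * ennreal \<bar>edet T\<bar>
       = (\<integral>\<^sup>+x. h x \<partial>distr M borel (inv expG))"
proof -
  let ?\<mu> = "distr M borel (inv expG)"
  have sets [measurable_cong]: "sets M = sets borel" and inv: "distr M borel (\<lambda>x. a + x) = M" for a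
    using M by (auto simp: haar_measure_def)
  have [measurable]: "inv expG \<in> borel_measurable borel"
    by (rule borel_measurable_continuous_onI[OF continuous_log])
  have [measurable]: "(\<lambda>x. a + x) \<in> borel_measurable borel" for a :: 'g
    by (intro borel_measurable_continuous_onI continuous_intros)
  have bl: "bounded_linear T" using T by (simp add: lie_algebra_morphism_def linear_conv_bounded_linear)
  have [measurable]: "T \<in> borel_measurable borel"
    by (intro borel_measurable_continuous_onI linear_continuous_on bl)
  note fin' = emeasure_distr_log_compact[OF M]
  have inv': "(\<integral>\<^sup>+x. h (mult a x) \<partial>?\<mu>) = (\<integral>\<^sup>+x. h x \<partial>?\<mu>)" if [measurable]: "h \<in> borel_measurable borel" for a and h :: "'a \<Rightarrow> ennreal"
  proof -
    have "(\<integral>\<^sup>+x. h (mult a x) \<partial>?\<mu>) = (\<integral>\<^sup>+x. h (inv expG (expG a + x)) \<partial>M)"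
      by (subst nn_integral_distr, measurable) (simp add: mult_def)
    also have "\<dots> = (\<integral>\<^sup>+x. h (inv expG x) \<partial>distr M borel (\<lambda>x. expG a + x))"
      by (simp add: nn_integral_distr)
    also have "\<dots> = (\<integral>\<^sup>+x. h x \<partial>?\<mu>)"
      by (simp add: inv nn_integral_distr)
    finally show ?thesis .
  qed
  note unique = left_invariant_unique[of ?\<mu>, OF _ fin' inv', simplified]
  let ?B = "ball 0 1 :: 'a set"
  have "emeasure chart_haar ?B * ((\<integral>\<^sup>+x. h (T x) \<partial>?\<mu>) * ennreal \<bar>edet T\<bar>)
      = emeasure ?\<mu> ?B * ((\<integral>\<^sup>+x. h (T x) \<partial>chart_haar) * ennreal \<bar>edet T\<bar>)"
    using unique[of "\<lambda>x. h (T x)"] by (simp flip: mult.assoc)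
  also have "\<dots> = emeasure chart_haar ?B * (\<integral>\<^sup>+x. h x \<partial>?\<mu>)"
    using unique[of h] by (simp add: nn_integral_chart_haar_morphism[OF T bij det])
  finally have "emeasure chart_haar ?B * ((\<integral>\<^sup>+x. h (T x) \<partial>?\<mu>) * ennreal \<bar>edet T\<bar>)
      = emeasure chart_haar ?B * (\<integral>\<^sup>+x. h x \<partial>?\<mu>)" .
  moreover have "emeasure chart_haar ?B > 0" by (rule chart_haar_open) auto
  moreover have "emeasure chart_haar ?B < \<infinity>"
    using order_le_less_trans[OF emeasure_mono[OF ball_subset_cball] chart_haar_compact[of "cball 0 1"]] by simp
  ultimately show ?thesis
    by (auto simp: ennreal_mult_cancel_left)
qed

end

section \<open>Dilations\<close>

definition diag :: "('a::euclidean_space \<Rightarrow> real) \<Rightarrow> 'a \<Rightarrow> 'a" where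
  "diag c x = (\<Sum>e\<in>Basis. (c e * (x \<bullet> e)) *\<^sub>R e)"

lemma diag_inner: "e \<in> Basis \<Longrightarrow> diag c x \<bullet> e = c e * (x \<bullet> e)"
  by (simp add: diag_def inner_sum_left_Basis)

lemma linear_diag: "linear (diag c)"
  by (intro linearI) (auto simp: diag_def algebra_simps sum.distrib scaleR_sum_right)

lemma diag_diag: "diag c (diag d x) = diag (\<lambda>e. c e * d e) x"
  by (rule euclidean_eqI) (simp add: diag_inner mult.assoc)

lemma diag_one: "diag (\<lambda>e. 1) x = x"
  by (rule euclidean_eqI) (simp add: diag_inner)

lemma scaleR_diag: "a *\<^sub>R diag c x = diag (\<lambda>e. a * c e) x"
  by (rule euclidean_eqI) (simp add: diag_inner mult.assoc)

text \<open>\<open>S\<close> maps the standard basis bijectively onto an eigenbasis, so that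
  \<open>A\<close> becomes multiplication of each coordinate by an eigenvalue.\<close>

lemma diagonalisable_conjugate_diag:
  fixes A :: "'a::euclidean_space \<Rightarrow> 'a"
  assumes A: "linear A" and "diagonalisable A"
  obtains S S' :: "'a \<Rightarrow> 'a" and c :: "'a \<Rightarrow> real" where "linear S" "linear S'" "\<And>x. S (S' x) = x" "\<And>x. S' (S x) = x"
    "\<And>x. A x = S (diag c (S' x))"
proof -
  obtain B where B: "independent B" "span B = UNIV" "\<forall>b\<in>B. \<exists>c. A b = c *\<^sub>R b"
    using assms(2) by (auto simp: diagonalisable_def)
  obtain k where k: "\<And>b. b \<in> B \<Longrightarrow> A b = k b *\<^sub>R b" using B(3) by metis
  have "card B = DIM('a)"
    using B(1,2) by (metis dim_UNIV dim_span_eq_card_independent)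
  then obtain h where h: "bij_betw h (Basis :: 'a set) B"
    using finite_same_card_bij[of "Basis :: 'a set" B] independent_imp_finite[OF B(1)] by auto
  define S where "S x = (\<Sum>e\<in>Basis. (x \<bullet> e) *\<^sub>R h e)" for x :: 'a
  have S: "linear S"
    by (intro linearI) (auto simp: S_def algebra_simps sum.distrib scaleR_sum_right)
  have "S e = h e" if "e \<in> Basis" for e
    using that by (simp add: S_def inner_Basis if_distrib[of "\<lambda>c. c *\<^sub>R _"] cong: if_cong)
  then have "B \<subseteq> range S"
    using h by (metis bij_betw_imp_surj_on image_subset_iff rangeI)
  then have "span B \<subseteq> range S"
    by (rule span_minimal[OF _ linear_subspace_image[OF S subspace_UNIV]])
  then have "surj S"
    using B(2) by blast
  then obtain S' where S': "linear S'" "\<And>x. S' (S x) = x" "\<And>x. S (S' x) = x"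
    using linear_surjective_isomorphism[OF S] by auto
  have "A (S x) = S (diag (\<lambda>e. k (h e)) x)" for x
  proof -
    have "A (S x) = (\<Sum>e\<in>Basis. (x \<bullet> e) *\<^sub>R A (h e))"
      by (simp add: S_def linear_sum[OF A] linear_cmul[OF A])
    also have "\<dots> = (\<Sum>e\<in>Basis. (k (h e) * (x \<bullet> e)) *\<^sub>R h e)"
      using h by (intro sum.cong) (auto simp: k bij_betw_apply)
    finally show ?thesis by (simp add: S_def diag_inner)
  qed
  then show thesis
    using S S' by (metis that)
qed

text \<open>The cyclic property of the trace. It makes a trace taken in the standard basis
  computable after conjugation to diagonal form.\<close>

lemma homogeneous_dimension_commute:
  fixes F G :: "'a::euclidean_space \<Rightarrow> 'a"
  assumes "linear F" "linear G"
  shows "homogeneous_dimension (\<lambda>x. F (G x)) = homogeneous_dimension (\<lambda>x. G (F x))"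
proof -
  have expand: "homogeneous_dimension (\<lambda>x. F (G x)) = (\<Sum>e\<in>Basis. \<Sum>e'\<in>Basis. (G e \<bullet> e') * (F e' \<bullet> e))"
    if F: "linear F" for F G :: "'a \<Rightarrow> 'a"
  proof -
    have "F (G e) \<bullet> e = (\<Sum>e'\<in>Basis. (G e \<bullet> e') * (F e' \<bullet> e))" for e
      by (subst euclidean_representation[of "G e", symmetric])
        (simp only: linear_sum[OF F] linear_cmul[OF F] inner_sum_left inner_scaleR_left)
    then show ?thesis by (simp add: homogeneous_dimension_def)
  qed
  show ?thesis
    unfolding expand[OF assms(1)] expand[OF assms(2)]
    by (subst sum.swap) (simp add: mult.commute)
qed

lemma homogeneous_dimension_diag: "homogeneous_dimension (diag c) = (\<Sum>e\<in>Basis. c e)"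
  by (simp add: homogeneous_dimension_def diag_inner inner_same_Basis)

lemma edet_diag: "edet (diag c) = (\<Prod>e\<in>Basis. c e)"
proof -
  let ?M = "matrix (\<lambda>v. to_vec (diag c (of_vec v)))"
  have ax: "of_vec (axis j 1) = basis_enum j" for j :: "'a dim_index"
    by (simp add: of_vec_def axis_def if_distrib[of "\<lambda>c. c *\<^sub>R _"] cong: if_cong)
  have mem: "basis_enum i \<in> Basis" for i :: "'a dim_index"
    using bij_betw_basis_enum by (auto simp: bij_betw_def)
  have M: "?M $ i $ j = (if i = j then c (basis_enum i) else 0)" for i j
    unfolding matrix_def ax to_vec_def by (simp add: diag_inner mem inner_basis_enum)
  have "det ?M = (\<Prod>i\<in>UNIV. ?M $ i $ i)"
    by (rule det_diagonal) (simp add: M)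
  then show ?thesis
    by (simp add: edet_def M prod_basis_enum)
qed

text \<open>Conjugation commutes with powers, and the series then converges coordinate by coordinate
  to scalar exponentials.\<close>

lemma algebra_dilation_diag:
  fixes S S' :: "'a::euclidean_space \<Rightarrow> 'a"
  assumes S: "linear S" "linear S'" and inv: "\<And>x. S' (S x) = x" "\<And>x. S (S' x) = x"
    and A: "\<And>x. A x = S (diag c (S' x))"
  shows "algebra_dilation A l X = S (diag (\<lambda>e. exp (ln l * c e)) (S' X))"
proof -
  let ?z = "\<lambda>e. ln l * c e"
  have pow: "((\<lambda>Y. ln l *\<^sub>R A Y) ^^ k) X = S (diag (\<lambda>e. ?z e ^ k) (S' X))" for k
  proof (induction k)
    case 0 then show ?case by (simp add: diag_one inv)
  next
    case (Suc k)
    show ?case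
      unfolding funpow.simps o_def Suc
      by (simp add: A inv diag_diag scaleR_diag mult.assoc linear_cmul[OF S(1), symmetric])
  qed
  have "(\<lambda>k. diag (\<lambda>e. ?z e ^ k / fact k) (S' X)) sums diag (\<lambda>e. exp (?z e)) (S' X)"
    unfolding diag_def
    by (intro sums_sum sums_scaleR_left sums_mult2) (use exp_converges[of "?z e" for e] in \<open>simp add: divide_inverse mult.commute\<close>)
  from bounded_linear.sums[OF linear_conv_bounded_linear[THEN iffD1, OF S(1)] this]
  have "(\<lambda>k. S (diag (\<lambda>e. ?z e ^ k / fact k) (S' X))) sums S (diag (\<lambda>e. exp (?z e)) (S' X))" .
  moreover have "S (diag (\<lambda>e. ?z e ^ k / fact k) (S' X)) = (1 / fact k) *\<^sub>R ((\<lambda>Y. ln l *\<^sub>R A Y) ^^ k) X" for k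
    unfolding pow linear_cmul[OF S(1), symmetric]
    by (rule arg_cong[where f=S], rule euclidean_eqI) (simp add: diag_inner)
  ultimately show ?thesis
    unfolding algebra_dilation_def by (simp add: sums_unique[symmetric])
qed

text \<open>The flow and the Hardy inequality along it are developed for a bare operator on a
  Euclidean space. The group enters afterwards, through a measure and a quasi-norm that scale along
  the flow.\<close>

locale diagonalisable_operator =
  fixes A :: "'a::euclidean_space \<Rightarrow> 'a"
  assumes linear: "linear A" and diagonalisable: "diagonalisable A"
begin

text \<open>Logarithmic time turns the dilations into an additive one-parameter group generated by
  \<open>A\<close>.\<close>

definition flow :: "real \<Rightarrow> 'a \<Rightarrow> 'a" where
  "flow t = algebra_dilation A (exp t)"

lemma flow_diag:
  obtains S S' :: "'a \<Rightarrow> 'a" and c :: "'a \<Rightarrow> real" where "linear S" "linear S'" "\<And>x. S (S' x) = x" "\<And>x. S' (S x) = x"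
    "\<And>x. A x = S (diag c (S' x))" "\<And>t x. flow t x = S (diag (\<lambda>e. exp (t * c e)) (S' x))"
proof (rule diagonalisable_conjugate_diag[OF linear diagonalisable])
  fix S S' :: "'a \<Rightarrow> 'a" and c :: "'a \<Rightarrow> real"
  assume *: "linear S" "linear S'" "\<And>x. S (S' x) = x" "\<And>x. S' (S x) = x"
    "\<And>x. A x = S (diag c (S' x))"
  show thesis
    by (rule that[OF *]) (simp_all only: flow_def algebra_dilation_diag[OF *(1,2,4,3,5)] ln_exp)
qed

lemma linear_flow: "linear (flow t)"
proof (rule flow_diag)
  fix S S' :: "'a \<Rightarrow> 'a" and c :: "'a \<Rightarrow> real"
  assume S: "linear S" "linear S'" and flow: "\<And>t x. flow t x = S (diag (\<lambda>e. exp (t * c e)) (S' x))"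
  have "flow t = S \<circ> (diag (\<lambda>e. exp (t * c e)) \<circ> S')"
    by (rule ext) (simp only: flow o_def)
  then show ?thesis
    by (metis linear_compose linear_diag S)
qed

lemma flow_0 [simp]: "flow 0 x = x"
proof (rule flow_diag)
  fix S S' :: "'a \<Rightarrow> 'a" and c :: "'a \<Rightarrow> real"
  assume "\<And>x. S (S' x) = x" "\<And>t x. flow t x = S (diag (\<lambda>e. exp (t * c e)) (S' x))"
  then show ?thesis by (simp add: diag_one)
qed

lemma flow_add: "flow s (flow t x) = flow (s + t) x"
proof (rule flow_diag)
  fix S S' :: "'a \<Rightarrow> 'a" and c :: "'a \<Rightarrow> real"
  assume "\<And>x. S' (S x) = x" "\<And>t x. flow t x = S (diag (\<lambda>e. exp (t * c e)) (S' x))"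
  then show ?thesis by (simp add: diag_diag distrib_right exp_add)
qed

lemma flow_flow_minus [simp]: "flow t (flow (- t) x) = x" "flow (- t) (flow t x) = x"
  by (simp_all add: flow_add)

lemma bij_flow: "bij (flow t)"
  by (rule o_bij[of "flow (- t)"]) (simp_all add: fun_eq_iff)

text \<open>The determinant of the exponential of \<open>t A\<close> is the exponential of
  \<open>t\<close> times the trace. The conjugating maps drop out of both the determinant and the
  trace, which leaves the diagonal case.\<close>

lemma edet_flow: "edet (flow t) = exp (t * homogeneous_dimension A)"
proof (rule flow_diag)
  fix S S' :: "'a \<Rightarrow> 'a" and c :: "'a \<Rightarrow> real"
  assume S: "linear S" "linear S'" and inv: "\<And>x. S (S' x) = x" "\<And>x. S' (S x) = x"
    and A: "\<And>x. A x = S (diag c (S' x))"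
    and flow: "\<And>t x. flow t x = S (diag (\<lambda>e. exp (t * c e)) (S' x))"
  have l: "linear (\<lambda>x. diag c (S' x))" for c
    using linear_compose[OF S(2) linear_diag] by (simp add: o_def)
  have "edet (flow t) = edet S * (edet (diag (\<lambda>e. exp (t * c e))) * edet S')"
    using edet_compose[OF S(1) l] edet_compose[OF linear_diag S(2)]
    by (simp add: flow[abs_def])
  also have "edet S * edet S' = 1"
    using edet_compose[OF S] by (simp add: inv edet_id)
  then have "edet S * (edet (diag (\<lambda>e. exp (t * c e))) * edet S') = edet (diag (\<lambda>e. exp (t * c e)))"
    by (metis mult.left_commute mult.right_neutral)
  also have "\<dots> = exp (t * (\<Sum>e\<in>Basis. c e))"
    by (simp add: edet_diag exp_sum sum_distrib_left)
  also have "(\<Sum>e\<in>Basis. c e) = homogeneous_dimension A"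
    using homogeneous_dimension_commute[OF S(1) l, of c]
    by (simp add: A[abs_def] inv homogeneous_dimension_diag)
  finally show ?thesis .
qed

lemma flow_has_vector_derivative: "((\<lambda>t. flow t x) has_vector_derivative A (flow t x)) (at t)"
proof (rule flow_diag)
  fix S S' :: "'a \<Rightarrow> 'a" and c :: "'a \<Rightarrow> real"
  assume S: "linear S" "linear S'" and inv: "\<And>x. S (S' x) = x" "\<And>x. S' (S x) = x"
    and A: "\<And>x. A x = S (diag c (S' x))"
    and flow: "\<And>t x. flow t x = S (diag (\<lambda>e. exp (t * c e)) (S' x))"
  have "((\<lambda>t. diag (\<lambda>e. exp (t * c e)) (S' x)) has_vector_derivative
      (\<Sum>e\<in>Basis. (c e * exp (t * c e) * (S' x \<bullet> e)) *\<^sub>R e)) (at t)"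
    unfolding diag_def
    by (intro has_vector_derivative_sum) (auto intro!: derivative_eq_intros simp: has_vector_derivative_def)
  moreover have "(\<Sum>e\<in>Basis. (c e * exp (t * c e) * (S' x \<bullet> e)) *\<^sub>R e) = diag c (diag (\<lambda>e. exp (t * c e)) (S' x))"
    by (simp add: diag_diag) (simp add: diag_def)
  ultimately have "((\<lambda>t. diag (\<lambda>e. exp (t * c e)) (S' x)) has_vector_derivative
      diag c (diag (\<lambda>e. exp (t * c e)) (S' x))) (at t)" by simp
  from bounded_linear.has_vector_derivative[OF linear_conv_bounded_linear[THEN iffD1, OF S(1)] this]
  show ?thesis by (simp add: flow A inv)
qed

lemma continuous_on_flow: "continuous_on U (\<lambda>p. flow (fst p) (snd p))"
proof (rule flow_diag)
  fix S S' :: "'a \<Rightarrow> 'a" and c :: "'a \<Rightarrow> real"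
  assume S: "linear S" "linear S'"
    and flow: "\<And>t x. flow t x = S (diag (\<lambda>e. exp (t * c e)) (S' x))"
  note bl = S[THEN linear_conv_bounded_linear[THEN iffD1]]
  have "continuous_on U (\<lambda>p. \<Sum>e\<in>Basis. (exp (fst p * c e) * (S' (snd p) \<bullet> e)) *\<^sub>R e)"
    by (intro continuous_intros bounded_linear.continuous_on[OF bl(2)])
  then show ?thesis
    unfolding flow diag_def by (rule bounded_linear.continuous_on[OF bl(1)])
qed

end

section \<open>The logarithmic Hardy inequality along a flow\<close>

text \<open>Continuity is asked on \<open>K\<close> alone, because the integrands below have
  denominators that can vanish elsewhere. A bound on \<open>K\<close>, a set of finite measure,
  gives integrability.\<close>

lemma integrable_continuous_compact_support:
  fixes h :: "'a::euclidean_space \<Rightarrow> real"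
  assumes sets: "sets \<mu> = sets borel" and fin: "\<And>K. compact K \<Longrightarrow> emeasure \<mu> K < \<infinity>"
    and K: "compact K" and h: "continuous_on K h" and zero: "\<And>x. x \<notin> K \<Longrightarrow> h x = 0"
  shows "integrable \<mu> h" "h \<in> borel_measurable borel"
proof -
  have Kb: "K \<in> sets borel" using K by (rule borel_compact)
  have eq: "h = (\<lambda>x. indicator K x *\<^sub>R h x)"
    using zero by (auto simp: fun_eq_iff indicator_def)
  show m: "h \<in> borel_measurable borel"
    by (subst eq) (rule borel_measurable_continuous_on_indicator[OF Kb h])
  obtain C where C: "\<And>x. x \<in> K \<Longrightarrow> norm (h x) \<le> C"
    using compact_imp_bounded[OF compact_continuous_image[OF h K]] unfolding bounded_iff by auto
  show "integrable \<mu> h"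
  proof (rule integrableI_bounded_set[of K _ _ C])
    show "K \<in> sets \<mu>" using Kb sets by simp
    show "h \<in> borel_measurable \<mu>" using m sets by (simp cong: measurable_cong_sets)
    show "emeasure \<mu> K < \<infinity>" by (rule fin[OF K])
    show "AE x in \<mu>. x \<in> K \<longrightarrow> norm (h x) \<le> C" using C by simp
    show "AE x in \<mu>. x \<notin> K \<longrightarrow> h x = 0" using zero by simp
  qed
qed

context diagonalisable_operator
begin

lemma borel_measurable_flow: "flow t \<in> borel_measurable borel"
  using linear_flow by (intro borel_measurable_continuous_onI linear_continuous_on) (simp add: linear_conv_bounded_linear)

text \<open>The scaling hypothesis speaks of nonnegative functions. Applied to indicators, it
  identifies the push-forward of \<open>\<mu>\<close> under the flow with a constant multiple of
  \<open>\<mu>\<close>, against which signed functions can be integrated.\<close>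

lemma integral_flow:
  fixes h :: "'a \<Rightarrow> real"
  assumes sets: "sets \<mu> = sets borel"
    and scale: "\<And>t h. h \<in> borel_measurable borel \<Longrightarrow>
      (\<integral>\<^sup>+x. h (flow t x) \<partial>\<mu>) * ennreal (exp (t * q)) = (\<integral>\<^sup>+x. h x \<partial>\<mu>)"
    and h: "integrable \<mu> h"
  shows "integrable \<mu> (\<lambda>x. h (flow t x))" "(\<integral>x. h (flow t x) \<partial>\<mu>) = exp (- (t * q)) * (\<integral>x. h x \<partial>\<mu>)"
proof -
  have hm: "h \<in> borel_measurable borel"
    using borel_measurable_integrable[OF h] sets by (simp cong: measurable_cong_sets)
  have fm: "flow t \<in> measurable \<mu> borel"
    using borel_measurable_flow sets by (simp cong: measurable_cong_sets)
  have inv: "ennreal (exp (- (t * q))) * (a * ennreal (exp (t * q))) = a" for a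
  proof -
    have "ennreal (exp (- (t * q))) * ennreal (exp (t * q)) = 1"
      by (simp add: ennreal_mult[symmetric] exp_minus_inverse mult.commute flip: exp_add)
    then show ?thesis by (metis mult.left_commute mult.right_neutral)
  qed
  have distr: "distr \<mu> borel (flow t) = density \<mu> (\<lambda>_. ennreal (exp (- (t * q))))"
  proof (rule measure_eqI)
    fix B assume "B \<in> sets (distr \<mu> borel (flow t))"
    then have B: "B \<in> sets borel" by simp
    then have ind: "(indicator B :: 'a \<Rightarrow> ennreal) \<in> borel_measurable borel" by simp
    have "emeasure (distr \<mu> borel (flow t)) B = (\<integral>\<^sup>+x. indicator B (flow t x) \<partial>\<mu>)"
      using B fm by (simp flip: nn_integral_indicator add: nn_integral_distr)
    also have "\<dots> = ennreal (exp (- (t * q))) * emeasure \<mu> B"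
      using scale[OF ind, of t] inv[of "\<integral>\<^sup>+x. indicator B (flow t x) \<partial>\<mu>"] B sets by simp
    also have "\<dots> = emeasure (density \<mu> (\<lambda>_. ennreal (exp (- (t * q))))) B"
      using B sets by (simp add: emeasure_density nn_integral_cmult)
    finally show "emeasure (distr \<mu> borel (flow t)) B = emeasure (density \<mu> (\<lambda>_. ennreal (exp (- (t * q))))) B" .
  qed (simp add: sets)
  have "integrable (distr \<mu> borel (flow t)) h"
    unfolding distr using h borel_measurable_integrable[OF h]
    by (subst integrable_density) auto
  then show "integrable \<mu> (\<lambda>x. h (flow t x))"
    by (subst (asm) integrable_distr_eq[OF fm hm])
  have "(\<integral>x. h (flow t x) \<partial>\<mu>) = (\<integral>x. h x \<partial>distr \<mu> borel (flow t))"
    by (rule integral_distr[OF fm hm, symmetric])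
  also have "\<dots> = exp (- (t * q)) * (\<integral>x. h x \<partial>\<mu>)"
    unfolding distr using borel_measurable_integrable[OF h]
    by (subst integral_density) auto
  finally show "(\<integral>x. h (flow t x) \<partial>\<mu>) = exp (- (t * q)) * (\<integral>x. h x \<partial>\<mu>)" .
qed

text \<open>The dilation field has divergence \<open>q\<close>: differentiate \<open>\<integral> g (flow t x) d\<mu> = e\<^sup>-\<^sup>q\<^sup>t \<integral> g d\<mu>\<close> at \<open>t = 0\<close>.\<close>

lemma integral_derivative_along_flow:
  fixes g G :: "'a \<Rightarrow> real"
  assumes sets: "sets \<mu> = sets borel" and fin: "\<And>K. compact K \<Longrightarrow> emeasure \<mu> K < \<infinity>"
    and scale: "\<And>t h. h \<in> borel_measurable borel \<Longrightarrow>
      (\<integral>\<^sup>+x. h (flow t x) \<partial>\<mu>) * ennreal (exp (t * q)) = (\<integral>\<^sup>+x. h x \<partial>\<mu>)"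
    and K: "compact K" and g: "continuous_on K g" "\<And>x. x \<notin> K \<Longrightarrow> g x = 0"
    and G: "continuous_on K G" "\<And>x. x \<notin> K \<Longrightarrow> G x = 0"
    and der: "\<And>t x. ((\<lambda>t. g (flow t x)) has_real_derivative G (flow t x)) (at t)"
  shows "(\<integral>x. G x \<partial>\<mu>) = - q * (\<integral>x. g x \<partial>\<mu>)"
proof -
  note ig = integrable_continuous_compact_support[OF sets fin K g]
  note iG = integrable_continuous_compact_support[OF sets fin K G]
  obtain C where C: "\<And>x. x \<in> K \<Longrightarrow> norm (G x) \<le> C"
    using compact_imp_bounded[OF compact_continuous_image[OF G(1) K]] unfolding bounded_iff by auto
  \<comment> \<open>\<open>K'\<close> contains every point whose orbit meets \<open>K\<close> during
    the times from 0 to 1. The steps \<open>t n\<close> are at most 1, so the difference quotients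
    vanish outside \<open>K'\<close>.\<close>
  define K' where "K' = (\<lambda>p. flow (fst p) (snd p)) ` ({-1..0} \<times> K)"
  have K': "compact K'"
    unfolding K'_def by (intro compact_continuous_image continuous_on_flow compact_Times K) simp
  define t where "t n = inverse (real (Suc n))" for n
  have t: "0 < t n" "t n \<le> 1" for n by (auto simp: t_def inverse_le_1_iff)
  have t0: "t \<longlonglongrightarrow> 0"
    using LIMSEQ_inverse_real_of_nat by (simp add: t_def[abs_def])
  then have tf: "filterlim t (at 0) sequentially"
    using t(1) by (auto simp: filterlim_at eventually_sequentially less_imp_neq[symmetric] intro!: always_eventually)
  define s where "s n x = (g (flow (t n) x) - g x) / t n" for n x
  \<comment> \<open>By the mean value theorem the quotient is a value of \<open>G\<close> on the
    orbit of \<open>x\<close>; this provides the majorant for dominated convergence.\<close>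
  have bound: "norm (s n x) \<le> C * indicator K' x" for n x
  proof -
    have "\<exists>\<xi>. 0 < \<xi> \<and> \<xi> < t n \<and> g (flow (t n) x) - g (flow 0 x) = (t n - 0) * G (flow \<xi> x)"
      by (rule MVT2[OF t(1)]) (rule der)
    then obtain \<xi> where \<xi>: "0 < \<xi>" "\<xi> < t n" and e: "g (flow (t n) x) - g x = t n * G (flow \<xi> x)"
      by auto
    have "s n x = G (flow \<xi> x)" using t(1)[of n] by (simp add: s_def e)
    moreover have "x \<in> K'" if "flow \<xi> x \<in> K"
      unfolding K'_def using \<xi> t(2)[of n] that
      by (intro image_eqI[of _ _ "(- \<xi>, flow \<xi> x)"]) auto
    moreover have "0 \<le> C" if "flow \<xi> x \<in> K" using C[OF that] norm_ge_zero order_trans by blast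
    ultimately show ?thesis
      using C[of "flow \<xi> x"] G(2)[of "flow \<xi> x"] order_trans[OF norm_ge_zero C]
      by (cases "flow \<xi> x \<in> K"; cases "x \<in> K'") (auto simp: K'_def)
  qed
  have lim: "(\<lambda>n. s n x) \<longlonglongrightarrow> G x" for x
    using filterlim_compose[OF der[of x 0, unfolded DERIV_def] tf] by (simp add: s_def[abs_def])
  have int_s: "integrable \<mu> (s n)" "(\<integral>x. s n x \<partial>\<mu>) = (exp (- (t n * q)) - 1) / t n * (\<integral>x. g x \<partial>\<mu>)" for n
    using integral_flow[OF sets scale ig(1), of "t n"] ig(1)
    by (simp_all add: s_def[abs_def] diff_divide_distrib left_diff_distrib)
  have "(\<lambda>n. \<integral>x. s n x \<partial>\<mu>) \<longlonglongrightarrow> (\<integral>x. G x \<partial>\<mu>)"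
  proof (rule integral_dominated_convergence)
    show "integrable \<mu> (\<lambda>x. C * indicator K' x)"
      using K' fin[OF K'] sets by (intro integrable_mult_right integrable_real_indicator) (auto simp: borel_compact)
    show "G \<in> borel_measurable \<mu>" by (rule borel_measurable_integrable[OF iG(1)])
    show "s n \<in> borel_measurable \<mu>" for n by (rule borel_measurable_integrable[OF int_s(1)])
  qed (use lim bound in auto)
  moreover have "(\<lambda>n. \<integral>x. s n x \<partial>\<mu>) \<longlonglongrightarrow> - q * (\<integral>x. g x \<partial>\<mu>)"
  proof -
    have "((\<lambda>t. exp (- (t * q))) has_real_derivative - q) (at 0)"
      by (auto intro!: derivative_eq_intros)
    from filterlim_compose[OF this[unfolded DERIV_def] tf]
    have "(\<lambda>n. (exp (- (t n * q)) - 1) / t n) \<longlonglongrightarrow> - q" by simp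
    from tendsto_mult_right[OF this, of "\<integral>x. g x \<partial>\<mu>"] show ?thesis by (simp add: int_s(2))
  qed
  ultimately show ?thesis by (rule LIMSEQ_unique)
qed

lemma has_vector_derivative_flow:
  assumes "(u has_derivative u') (at (flow t x))"
  shows "((\<lambda>t. u (flow t x)) has_vector_derivative u' (A (flow t x))) (at t)"
  using has_derivative_compose[OF flow_has_vector_derivative[unfolded has_vector_derivative_def] assms]
  by (simp add: has_vector_derivative_def linear_cmul[OF has_derivative_linear[OF assms]])

text \<open>Here \<open>v\<close> is the derivative in flow time, which corresponds to
  \<open>N\<close> times the radial derivative; hence the weight on the right-hand side. The scaling
  exponent 2 of \<open>\<mu>\<close> matches the factor \<open>(N x)\<^sup>2\<close>.\<close>

lemma log_hardy_flow:
  fixes u v :: "'a \<Rightarrow> complex" and N :: "'a \<Rightarrow> real"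
  assumes sets: "sets \<mu> = sets borel" and fin: "\<And>K. compact K \<Longrightarrow> emeasure \<mu> K < \<infinity>"
    and scale: "\<And>t h. h \<in> borel_measurable borel \<Longrightarrow>
      (\<integral>\<^sup>+x. h (flow t x) \<partial>\<mu>) * ennreal (exp (t * 2)) = (\<integral>\<^sup>+x. h x \<partial>\<mu>)"
    and N: "continuous_on UNIV N" "\<And>t x. N (flow t x) = exp t * N x"
    and K: "compact K" "\<And>x. x \<in> K \<Longrightarrow> 0 < N x \<and> N x < R"
    and u: "continuous_on UNIV u" "\<And>x. x \<notin> K \<Longrightarrow> u x = 0"
    and v: "continuous_on UNIV v" "\<And>x. x \<notin> K \<Longrightarrow> v x = 0"
    and der: "\<And>t x. ((\<lambda>t. u (flow t x)) has_vector_derivative v (flow t x)) (at t)"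
  shows "(\<integral>x. (cmod (u x))\<^sup>2 / ((N x)\<^sup>2 * (ln (R / N x))\<^sup>2) \<partial>\<mu>)
    \<le> 4 * (\<integral>x. (cmod (v x))\<^sup>2 / (N x)\<^sup>2 \<partial>\<mu>)"
proof -
  define L where "L x = ln (R / N x)" for x
  have cont: "continuous_on K N" "continuous_on K u" "continuous_on K v"
    using N(1) u(1) v(1) continuous_on_subset by blast+
  have L_pos: "0 < L x" if "x \<in> K" for x
    using K(2)[OF that] by (simp add: L_def)
  have N_nz: "N x \<noteq> 0" and L_nz: "L x \<noteq> 0" if "x \<in> K" for x
    using K(2)[OF that] L_pos[OF that] by auto
  have cont_L: "continuous_on K L"
  proof -
    have "R / N x \<noteq> 0" if "x \<in> K" for x
      using K(2)[OF that] by auto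
    then show ?thesis
      unfolding L_def using cont(1) N_nz by (intro continuous_intros) auto
  qed
  have integrable: "integrable \<mu> h" if "continuous_on K h" "\<And>x. x \<notin> K \<Longrightarrow> h x = 0" for h :: "'a \<Rightarrow> real"
    by (rule integrable_continuous_compact_support(1)[OF sets fin K(1) that])
  \<comment> \<open>\<open>a\<close> and \<open>b\<close> are the two integrands, and
    \<open>g\<close> is the function to be differentiated along the flow. \<open>c\<close> collects
    the part of that derivative in which \<open>u\<close> is differentiated, with the real inner
    product of complex numbers.\<close>
  define a where "a x = (u x \<bullet> u x) / ((N x)\<^sup>2 * (L x)\<^sup>2)" for x
  define b where "b x = (v x \<bullet> v x) / (N x)\<^sup>2" for x
  define c where "c x = 2 * (u x \<bullet> v x) / ((N x)\<^sup>2 * L x)" for x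
  define g where "g x = (u x \<bullet> u x) / ((N x)\<^sup>2 * L x)" for x
  have cg: "continuous_on K g" and zg: "\<And>x. x \<notin> K \<Longrightarrow> g x = 0"
    unfolding g_def using N_nz L_nz by (auto intro!: continuous_intros cont cont_L simp: u(2))
  have ca: "continuous_on K a" and za: "\<And>x. x \<notin> K \<Longrightarrow> a x = 0"
    unfolding a_def using N_nz L_nz by (auto intro!: continuous_intros cont cont_L simp: u(2))
  have cb: "continuous_on K b" and zb: "\<And>x. x \<notin> K \<Longrightarrow> b x = 0"
    unfolding b_def using N_nz L_nz by (auto intro!: continuous_intros cont cont_L simp: v(2))
  have cc: "continuous_on K c" and zc: "\<And>x. x \<notin> K \<Longrightarrow> c x = 0"
    unfolding c_def using N_nz L_nz by (auto intro!: continuous_intros cont cont_L simp: u(2))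
  have "((\<lambda>t. g (flow t x)) has_real_derivative c (flow t x) - 2 * g (flow t x) + a (flow t x)) (at t)" for t x
  proof (cases "flow t x \<in> K")
    case False
    \<comment> \<open>\<open>K\<close> is closed, so an orbit outside it stays outside for nearby
      times, and there \<open>g\<close> is identically zero.\<close>
    have "continuous_on UNIV (\<lambda>t. flow t x)"
      by (intro continuous_at_imp_continuous_on ballI)
        (rule has_vector_derivative_continuous[OF flow_has_vector_derivative])
    from open_vimage[OF _ this, of "- K"] have opn: "open ((\<lambda>t. flow t x) -` (- K))"
      using K(1) by (simp add: compact_imp_closed open_Compl)
    have "((\<lambda>t. g (flow t x)) has_real_derivative 0) (at t)"
      by (rule has_field_derivative_transform_within_open[OF _ opn, of "\<lambda>t. 0"]) (use False zg in auto)
    then show ?thesis using False by (simp add: za zc zg)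
  next
    case True
    have "((\<lambda>t. u (flow t x) \<bullet> u (flow t x)) has_derivative
        (\<lambda>h. u (flow t x) \<bullet> (h *\<^sub>R v (flow t x)) + (h *\<^sub>R v (flow t x)) \<bullet> u (flow t x))) (at t)"
      using der[of x t] unfolding has_vector_derivative_def by (intro has_derivative_inner)
    then have du: "((\<lambda>t. u (flow t x) \<bullet> u (flow t x)) has_real_derivative 2 * (u (flow t x) \<bullet> v (flow t x))) (at t)"
      unfolding has_field_derivative_def
      by (rule has_derivative_eq_rhs) (simp add: fun_eq_iff inner_commute)
    have dN: "((\<lambda>t. N (flow t x)) has_real_derivative N (flow t x)) (at t)"
      unfolding N(2) by (auto intro!: derivative_eq_intros)
    \<comment> \<open>\<open>N\<close> grows like \<open>exp t\<close> along the flow, so its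
      logarithm grows, and \<open>L\<close> falls, at unit speed. This produces the term
      \<open>a\<close> with coefficient one.\<close>
    have dL: "((\<lambda>t. L (flow t x)) has_real_derivative - 1) (at t)"
      unfolding L_def using dN K(2)[OF True]
      by (auto intro!: derivative_eq_intros simp: field_simps power2_eq_square)
    have "((\<lambda>t. g (flow t x)) has_real_derivative
       (2 * (u (flow t x) \<bullet> v (flow t x)) * ((N (flow t x))\<^sup>2 * L (flow t x))
         - (u (flow t x) \<bullet> u (flow t x)) * (2 * N (flow t x) * N (flow t x) * L (flow t x) - (N (flow t x))\<^sup>2))
        / ((N (flow t x))\<^sup>2 * L (flow t x))\<^sup>2) (at t)"
      unfolding g_def using N_nz[OF True] L_nz[OF True]
      by (auto intro!: derivative_eq_intros du dN dL simp: power2_eq_square)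
    moreover have "(2 * p * (n\<^sup>2 * l) - r * (2 * n * n * l - n\<^sup>2)) / (n\<^sup>2 * l)\<^sup>2
        = 2 * p / (n\<^sup>2 * l) - 2 * (r / (n\<^sup>2 * l)) + r / (n\<^sup>2 * l\<^sup>2)"
      if "n \<noteq> 0" "l \<noteq> 0" for n l p r :: real
      using that by (simp add: field_simps power2_eq_square)
    ultimately show ?thesis
      using N_nz[OF True] L_nz[OF True] by (simp add: c_def g_def a_def)
  qed
  \<comment> \<open>The divergence is 2, so the integral of \<open>g\<close> occurs on both sides
    with the same factor and cancels: the integral of \<open>a\<close> is minus that of
    \<open>c\<close>.\<close>
  then have "(\<integral>x. c x - 2 * g x + a x \<partial>\<mu>) = - 2 * (\<integral>x. g x \<partial>\<mu>)"
    by (intro integral_derivative_along_flow[OF sets fin scale K(1) cg zg])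
      (auto intro!: continuous_intros ca cg cc simp: za zg zc)
  then have ac: "(\<integral>x. a x \<partial>\<mu>) = (\<integral>x. - c x \<partial>\<mu>)"
    using integrable[OF ca za] integrable[OF cc zc] integrable[OF cg zg] by simp
  have "- c x \<le> a x / 2 + 2 * b x" for x
  proof (cases "x \<in> K")
    case True
    \<comment> \<open>The weights make the square equal to \<open>a x + 2 * c x + 4 * b x\<close>.
      The resulting term \<open>a x / 2\<close> is absorbed after integration, which yields the
      constant 4.\<close>
    define w where "w = (1 / (N x * L x)) *\<^sub>R u x + (2 / N x) *\<^sub>R v x"
    have "0 \<le> w \<bullet> w" by simp
    also have "w \<bullet> w = a x + 2 * c x + 4 * b x"
      using N_nz[OF True] L_nz[OF True]
      by (simp add: w_def a_def b_def c_def inner_add_left inner_add_right inner_commute field_simps power2_eq_square)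
    finally show ?thesis by simp
  qed (simp add: za zb zc)
  then have "(\<integral>x. - c x \<partial>\<mu>) \<le> (\<integral>x. a x / 2 + 2 * b x \<partial>\<mu>)"
    using integrable[OF ca za] integrable[OF cb zb] integrable[OF cc zc]
    by (intro integral_mono) auto
  also have "\<dots> = (\<integral>x. a x \<partial>\<mu>) / 2 + 2 * (\<integral>x. b x \<partial>\<mu>)"
    using integrable[OF ca za] integrable[OF cb zb] by simp
  finally have "(\<integral>x. a x \<partial>\<mu>) \<le> 4 * (\<integral>x. b x \<partial>\<mu>)"
    unfolding ac[symmetric] by simp
  then show ?thesis
    by (simp add: a_def[abs_def] b_def[abs_def] L_def dot_square_norm)
qed

end

section \<open>Functions on a homogeneous group\<close>

context homogeneous_group
begin

sublocale diagonalisable_operator A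
  by (rule diagonalisable_operator.intro[OF linear_A diagonalisable_A])

text \<open>This holds for every real \<open>l\<close>, since \<open>algebra_dilation\<close> sees
  \<open>l\<close> only through \<open>ln l\<close>.\<close>

lemma dilation_eq_flow: "dilation expG A l x = expG (flow (ln l) (inv expG x))"
  by (simp add: dilation_def flow_def algebra_dilation_def)

lemma nn_integral_haar_flow:
  assumes "haar_measure M" "h \<in> borel_measurable borel"
  shows "(\<integral>\<^sup>+x. h (flow t x) \<partial>distr M borel (inv expG)) * ennreal (exp (t * homogeneous_dimension A))
       = (\<integral>\<^sup>+x. h x \<partial>distr M borel (inv expG))"
proof -
  have "lie_algebra_morphism expG (flow t)"
    using dilation_morphism[of "exp t"] by (simp add: flow_def)
  from nn_integral_haar_morphism[OF assms(1) this bij_flow _ assms(2)]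
  show ?thesis by (simp add: edet_flow)
qed

text \<open>With \<open>r = exp t\<close>, differentiation in \<open>r\<close> is differentiation in
  flow time divided by \<open>r\<close>. At the unit the curve is constant and the quotient by
  \<open>N 0 = 0\<close> is 0, so the formula persists there.\<close>

lemma radial_derivative_eq:
  assumes N: "homogeneous_quasi_norm expG A N"
    and u: "\<And>X. ((\<lambda>X. f (expG X)) has_derivative u' X) (at X)"
  shows "radial_derivative expG A N f (expG X) = u' X (A X) / N (expG X)"
proof (cases "X = 0")
  case True
  have N0: "N 0 = 0"
    using N by (simp add: homogeneous_quasi_norm_def)
  have "radial_derivative expG A N f 0 = vector_derivative (\<lambda>r. f (expG 0)) (at 0)"
    by (simp add: radial_derivative_def N0 dilation_eq_flow linear_0[OF linear_flow])
  then show ?thesis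
    using True N0 by simp
next
  case False
  define n where "n = N (expG X)"
  have "expG X \<noteq> 0"
    using False log_exp[of X] log_0 by metis
  then have n: "0 < n"
    using N unfolding homogeneous_quasi_norm_def n_def by (metis less_eq_real_def)
  have flow: "f (dilation expG A r (dilation expG A (1 / n) (expG X))) = f (expG (flow (ln r - ln n) X))" for r
    using n by (simp add: dilation_eq_flow flow_add ln_div)
  have "((\<lambda>t. f (expG (flow t X))) has_vector_derivative u' (flow 0 X) (A (flow 0 X))) (at 0)"
    by (rule has_vector_derivative_flow[OF u])
  then have "((\<lambda>t. f (expG (flow t X))) has_vector_derivative u' X (A X)) (at (ln n - ln n))"
    by simp
  moreover have "((\<lambda>r. ln r - ln n) has_vector_derivative 1 / n) (at n)"
    using n by (auto intro!: derivative_eq_intros simp: has_vector_derivative_def divide_inverse)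
  ultimately have "((\<lambda>r. f (expG (flow (ln r - ln n) X))) has_vector_derivative (1 / n) *\<^sub>R u' X (A X)) (at n)"
    using vector_diff_chain_at[of "\<lambda>r. ln r - ln n" "1 / n" n] by (simp add: o_def)
  then show ?thesis
    unfolding radial_derivative_def n_def[symmetric] flow
    by (simp add: vector_derivative_at scaleR_conv_of_real divide_inverse mult.commute)
qed

end

theorem theorem5p2:
  fixes expG :: "'a::euclidean_space \<Rightarrow> 'g::topological_group_add"
    and A :: "'a \<Rightarrow> 'a"
    and N :: "'g \<Rightarrow> real"
    and M :: "'g measure"
    and R :: real
    and f :: "'g \<Rightarrow> complex"
  assumes "homogeneous_group expG A"
    and "homogeneous_dimension A = 2"
    and "haar_measure M"
    and "homogeneous_quasi_norm expG A N"
    and "R > 0"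
    and "smooth_compactly_supported expG (quasi_ball N R - {0}) f"
  shows
    "(set_integrable M (quasi_ball N R)
       (\<lambda>x. 1 / ((N x)\<^sup>2 * \<bar>ln (R / N x)\<bar>\<^sup>2) * (cmod (f x - f (dilation expG A (R / N x) x)))\<^sup>2) \<and>
     set_integrable M (quasi_ball N R) (\<lambda>x. (cmod (radial_derivative expG A N f x))\<^sup>2) \<and>
     sqrt (LINT x:quasi_ball N R|M.
         1 / ((N x)\<^sup>2 * \<bar>ln (R / N x)\<bar>\<^sup>2) * (cmod (f x - f (dilation expG A (R / N x) x)))\<^sup>2)
       \<le> 2 * sqrt (LINT x:quasi_ball N R|M. (cmod (radial_derivative expG A N f x))\<^sup>2))
     \<and>
    (set_integrable M (quasi_ball N R)
       (\<lambda>x. (cmod (f x))\<^sup>2 / ((N x)\<^sup>2 * (1 + \<bar>ln (R / N x)\<bar>)\<^sup>2)) \<and>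
     set_integrable M (quasi_ball N R) (\<lambda>x. (cmod (f x))\<^sup>2) \<and>
     sqrt (LINT x:quasi_ball N R|M. (cmod (f x))\<^sup>2 / ((N x)\<^sup>2 * (1 + \<bar>ln (R / N x)\<bar>)\<^sup>2))
       \<le> sqrt 2 / R * sqrt (LINT x:quasi_ball N R|M. (cmod (f x))\<^sup>2)
         + 2 * (1 + sqrt 2) * sqrt (LINT x:quasi_ball N R|M. (cmod (radial_derivative expG A N f x))\<^sup>2))"
proof -
  interpret homogeneous_group expG A by fact
  note N = \<open>homogeneous_quasi_norm expG A N\<close>
  let ?\<mu> = "distr M borel (inv expG)" and ?B = "quasi_ball N R"
  define u where "u X = f (expG X)" for X
  define v where "v X = frechet_derivative u (at X) (A X)" for X
  define n where "n X = N (expG X)" for X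
  \<comment> \<open>The support in exponential coordinates. It is compact, avoids the unit and lies
    inside the open ball, so all weights are continuous on it.\<close>
  define K where "K = inv expG ` closure {x. f x \<noteq> 0}"
  have supp: "closure {x. f x \<noteq> 0} \<subseteq> ?B - {0}" and comp: "compact (closure {x. f x \<noteq> 0})"
    and smooth: "smooth u"
    using \<open>smooth_compactly_supported expG (?B - {0}) f\<close>
    by (auto simp: smooth_compactly_supported_def smooth_fun_def u_def[abs_def])
  have N_pos: "0 < N x" if "x \<noteq> 0" for x
    using N that unfolding homogeneous_quasi_norm_def by (metis less_eq_real_def)
  have N_dil: "N (dilation expG A l x) = l * N x" if "0 < l" for l x
    using N that by (simp add: homogeneous_quasi_norm_def)
  have K: "compact K"
    unfolding K_def by (rule compact_continuous_image[OF continuous_on_subset[OF continuous_log] comp]) simp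
  have "inj (inv expG)" by (rule inj_on_inverseI[of _ expG]) simp
  then have mem_K: "inv expG x \<in> K \<longleftrightarrow> x \<in> closure {x. f x \<noteq> 0}" for x
    unfolding K_def by (rule inj_image_mem_iff)
  have u0: "u X = 0" if "X \<notin> K" for X
    using that mem_K[of "expG X"] closure_subset[of "{x. f x \<noteq> 0}"] by (auto simp: u_def)
  have n_K: "0 < n X \<and> n X < R" if "X \<in> K" for X
    using that mem_K[of "expG X"] supp N_pos by (auto simp: n_def quasi_ball_def)
  have cont_n: "continuous_on UNIV n"
    unfolding n_def using N continuous_on_compose2[OF _ continuous_exp, of UNIV N]
    by (auto simp: homogeneous_quasi_norm_def)
  have der_u: "(u has_derivative frechet_derivative u (at X)) (at X)" for X
    by (rule smooth_has_derivative[OF smooth])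
  have cont_u: "continuous_on UNIV u"
    by (rule smooth_continuous_on[OF smooth])
  have cont_v: "continuous_on UNIV v"
  proof -
    \<comment> \<open>Continuity of the derivative is known for each fixed direction, so the moving
      direction \<open>A X\<close> is expanded in the basis.\<close>
    have v: "v X = (\<Sum>b\<in>Basis. (A X \<bullet> b) *\<^sub>R frechet_derivative u (at X) b)" for X
    proof -
      note lin = has_derivative_linear[OF der_u[of X]]
      show ?thesis
        unfolding v_def
        by (subst euclidean_representation[of "A X", symmetric])
          (simp only: linear_sum[OF lin] linear_cmul[OF lin])
    qed
    have "bounded_linear A" using linear_A by (simp add: linear_conv_bounded_linear)
    then show ?thesis
      unfolding v
      by (intro continuous_intros linear_continuous_on smooth_continuous_on[OF smooth_frechet_derivative[OF smooth]])
  qed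
  have v0: "v X = 0" if "X \<notin> K" for X
  proof -
    have opn: "open (- K)" using K by (simp add: compact_imp_closed open_Compl)
    have "(u has_derivative (\<lambda>_. 0)) (at X)"
      by (rule has_derivative_transform_within_open[OF has_derivative_const opn, of X 0]) (use that u0 in auto)
    from has_derivative_unique[OF this der_u] show ?thesis
      unfolding v_def by metis
  qed
  have sets: "sets ?\<mu> = sets borel" by simp
  have fin: "emeasure ?\<mu> C < \<infinity>" if "compact C" for C
    by (rule emeasure_distr_log_compact[OF \<open>haar_measure M\<close> that])
  have log_meas: "inv expG \<in> measurable M borel"
    using borel_measurable_continuous_onI[OF continuous_log] \<open>haar_measure M\<close>
    by (simp add: haar_measure_def cong: measurable_cong_sets)
  \<comment> \<open>Common transfer step: an integrand that agrees on the ball with a function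
    \<open>H\<close> supported in \<open>K\<close> can be integrated in the chart.\<close>
  have chart: "set_integrable M ?B F \<and> (LINT x:?B|M. F x) = (\<integral>X. H X \<partial>?\<mu>) \<and> integrable ?\<mu> H"
    if H: "continuous_on K H" "\<And>X. X \<notin> K \<Longrightarrow> H X = 0"
      and F: "\<And>X. expG X \<in> ?B \<Longrightarrow> F (expG X) = H X" for F :: "'g \<Rightarrow> real" and H :: "'a \<Rightarrow> real"
  proof -
    note int = integrable_continuous_compact_support[OF sets fin K H]
    have eq: "indicator ?B x *\<^sub>R F x = H (inv expG x)" for x
      using F[of "inv expG x"] H(2)[of "inv expG x"] supp mem_K[of x]
      by (cases "x \<in> ?B") auto
    show ?thesis
      unfolding set_integrable_def set_lebesgue_integral_def eq
      using int integral_distr[OF log_meas int(2)] integrable_distr_eq[OF log_meas int(2)] by simp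
  qed
  have n_nz: "n X \<noteq> 0" "R / n X \<noteq> 0" "0 < ln (R / n X)" if "X \<in> K" for X
    using n_K[OF that] by auto
  have cont: "continuous_on K n" "continuous_on K u" "continuous_on K v"
    using cont_n cont_u cont_v continuous_on_subset by blast+
  have cont_ln: "continuous_on K (\<lambda>X. ln (R / n X))"
    using n_nz by (intro continuous_intros cont) auto
  define H1 where "H1 X = (cmod (u X))\<^sup>2 / ((n X)\<^sup>2 * (ln (R / n X))\<^sup>2)" for X
  define H2 where "H2 X = (cmod (v X))\<^sup>2 / (n X)\<^sup>2" for X
  define H3 where "H3 X = (cmod (u X))\<^sup>2 / ((n X)\<^sup>2 * (1 + \<bar>ln (R / n X)\<bar>)\<^sup>2)" for X
  have c1: "set_integrable M ?B (\<lambda>x. 1 / ((N x)\<^sup>2 * \<bar>ln (R / N x)\<bar>\<^sup>2) * (cmod (f x - f (dilation expG A (R / N x) x)))\<^sup>2) \<and>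
      (LINT x:?B|M. 1 / ((N x)\<^sup>2 * \<bar>ln (R / N x)\<bar>\<^sup>2) * (cmod (f x - f (dilation expG A (R / N x) x)))\<^sup>2)
        = (\<integral>X. H1 X \<partial>?\<mu>) \<and> integrable ?\<mu> H1"
  proof (rule chart)
    show "continuous_on K H1"
      unfolding H1_def using n_nz by (intro continuous_intros cont cont_ln) (auto, force)
    show "H1 X = 0" if "X \<notin> K" for X using u0[OF that] by (simp add: H1_def)
    show "1 / ((N (expG X))\<^sup>2 * \<bar>ln (R / N (expG X))\<bar>\<^sup>2)
        * (cmod (f (expG X) - f (dilation expG A (R / N (expG X)) (expG X))))\<^sup>2 = H1 X" for X
    proof (cases "expG X = 0")
      case True
      \<comment> \<open>At the unit both sides contain a division by zero and are therefore
        0.\<close>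
      then have "N (expG X) = 0" using N by (simp add: homogeneous_quasi_norm_def)
      then show ?thesis by (simp add: H1_def n_def)
    next
      case False
      \<comment> \<open>The rescaled point lies on the sphere of radius \<open>R\<close>, outside
        the open ball, so the subtracted value of \<open>f\<close> is zero.\<close>
      have "N (dilation expG A (R / N (expG X)) (expG X)) = R"
        using N_pos[OF False] \<open>R > 0\<close> by (simp add: N_dil)
      then have "f (dilation expG A (R / N (expG X)) (expG X)) = 0"
        using supp closure_subset[of "{x. f x \<noteq> 0}"] by (force simp: quasi_ball_def)
      then show ?thesis by (simp add: H1_def n_def u_def)
    qed
  qed
  have c2: "set_integrable M ?B (\<lambda>x. (cmod (radial_derivative expG A N f x))\<^sup>2) \<and>
      (LINT x:?B|M. (cmod (radial_derivative expG A N f x))\<^sup>2) = (\<integral>X. H2 X \<partial>?\<mu>) \<and> integrable ?\<mu> H2"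
  proof (rule chart)
    show "continuous_on K H2"
      unfolding H2_def using n_nz by (intro continuous_intros cont) auto
    show "H2 X = 0" if "X \<notin> K" for X using v0[OF that] by (simp add: H2_def)
    show "(cmod (radial_derivative expG A N f (expG X)))\<^sup>2 = H2 X" for X
      using radial_derivative_eq[OF N der_u[unfolded u_def[abs_def]], of X]
      by (simp add: H2_def v_def n_def u_def[abs_def] norm_divide power_divide)
  qed
  have c3: "set_integrable M ?B (\<lambda>x. (cmod (f x))\<^sup>2 / ((N x)\<^sup>2 * (1 + \<bar>ln (R / N x)\<bar>)\<^sup>2)) \<and>
      (LINT x:?B|M. (cmod (f x))\<^sup>2 / ((N x)\<^sup>2 * (1 + \<bar>ln (R / N x)\<bar>)\<^sup>2)) = (\<integral>X. H3 X \<partial>?\<mu>) \<and> integrable ?\<mu> H3"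
  proof (rule chart)
    show "continuous_on K H3"
      unfolding H3_def using n_nz by (intro continuous_intros cont cont_ln) (auto simp: add_nonneg_eq_0_iff)
    show "H3 X = 0" if "X \<notin> K" for X using u0[OF that] by (simp add: H3_def)
  qed (simp add: H3_def n_def u_def)
  have c4: "set_integrable M ?B (\<lambda>x. (cmod (f x))\<^sup>2) \<and>
      (LINT x:?B|M. (cmod (f x))\<^sup>2) = (\<integral>X. (cmod (u X))\<^sup>2 \<partial>?\<mu>) \<and> integrable ?\<mu> (\<lambda>X. (cmod (u X))\<^sup>2)"
    by (rule chart) (auto intro!: continuous_intros cont simp: u0, simp add: u_def)
  have hardy: "(\<integral>X. H1 X \<partial>?\<mu>) \<le> 4 * (\<integral>X. H2 X \<partial>?\<mu>)"
    unfolding H1_def H2_def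
  proof (rule log_hardy_flow[OF sets fin _ cont_n _ K n_K cont_u u0 cont_v v0])
    show "(\<integral>\<^sup>+x. h (flow t x) \<partial>?\<mu>) * ennreal (exp (t * 2)) = (\<integral>\<^sup>+x. h x \<partial>?\<mu>)"
      if "h \<in> borel_measurable borel" for t h
      using nn_integral_haar_flow[OF \<open>haar_measure M\<close> that, of t] \<open>homogeneous_dimension A = 2\<close> by simp
    show "n (flow t x) = exp t * n x" for t x
      using N_dil[of "exp t" "expG x"] by (simp add: n_def dilation_eq_flow)
    show "((\<lambda>t. u (flow t x)) has_vector_derivative v (flow t x)) (at t)" for t x
      unfolding v_def by (rule has_vector_derivative_flow[OF der_u])
  qed
  then have first: "sqrt (\<integral>X. H1 X \<partial>?\<mu>) \<le> 2 * sqrt (\<integral>X. H2 X \<partial>?\<mu>)"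
    using real_sqrt_le_mono[OF hardy] by (simp add: real_sqrt_mult)
  \<comment> \<open>On the support the logarithm is positive, so adding 1 to it enlarges the
    denominator.\<close>
  have "(\<integral>X. H3 X \<partial>?\<mu>) \<le> (\<integral>X. H1 X \<partial>?\<mu>)"
  proof (rule integral_mono)
    show "H3 X \<le> H1 X" for X
    proof (cases "X \<in> K")
      case True
      then show ?thesis
        unfolding H1_def H3_def using n_nz[OF True]
        by (intro divide_left_mono mult_left_mono power_mono mult_pos_pos) auto
    qed (simp add: H1_def H3_def u0)
  qed (use c1 c3 in auto)
  then have "sqrt (\<integral>X. H3 X \<partial>?\<mu>) \<le> 2 * sqrt (\<integral>X. H2 X \<partial>?\<mu>)"
    using first real_sqrt_le_mono order_trans by blast
  \<comment> \<open>The last two steps only weaken the bound: \<open>1 + sqrt 2\<close> is at least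
    1, and the term in \<open>f\<close> is nonnegative.\<close>
  also have "\<dots> \<le> 2 * (1 + sqrt 2) * sqrt (\<integral>X. H2 X \<partial>?\<mu>)"
    by (intro mult_right_mono real_sqrt_ge_zero integral_nonneg) (auto simp: H2_def)
  also have "\<dots> \<le> sqrt 2 / R * sqrt (\<integral>X. (cmod (u X))\<^sup>2 \<partial>?\<mu>) + \<dots>"
    using \<open>R > 0\<close> by simp
  finally show ?thesis
    using c1 c2 c3 c4 first by simp
qed

end
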